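(* Let $d\ge 2$ be a fixed integer and, for each $i\in\mathbb N$, let $2\le d_i\le d$ and let $A_i$ be a $d_i\times d_i$ matrix acting on $\mathbb R^{d_i}$. Let $\{A_i\}_{i\in\mathbb N}$ be a family of uniformly normalizable matrices. If the real parts of the eigenvalues of the matrices $A_1,A_2,\dots$ are negative, then for any $\theta>0$ and any $w=(w_1,w_2,\dots)\in B(\theta)$ the system $$\dot x_i=A_ix_i+w_i,\qquad x_i(0)=x_{i0}\in\mathbb R^{d_i},\qquad i=1,2,\dots$$ has a unique solution for any $x_0=(x_{10},x_{20},\dots)\in\ell^2$. Moreover, the corresponding components of the solution $x(t)=(x_1(t),x_2(t),\dots)$ are given by $$x_i(t)=e^{tA_i}x_{i0}+\int_0^t e^{(t-s)A_i}w_i(s)\,ds,\qquad i\in\mathbb N.$$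
   Context: $\ell^2$ denotes the Hilbert space of sequences $x=(x_1,x_2,\dots)$ with $x_i\in\mathbb R^{d_i}$ and $\|x\|^2=\sum_{i=1}^\infty\|x_i\|^2<\infty$, where $\|x_i\|$ is the Euclidean norm on $\mathbb R^{d_i}$. Uniformly normalizable: there exist a family $\{P_i\}_{i\in\mathbb N}$ of non-singular matrices and a constant $C\ge 1$ such that $\|P_i\|\cdot\|P_i^{-1}\|\le C$ and $P_iA_iP_i^{-1}$ is a matrix in Jordan normal form for all $i\in\mathbb N$. Admissible controls: $T>0$ is the length of the time interval under consideration. For $\theta>0$, $B(\theta)$ is the set of all functions $w=(w_1,w_2,\dots):[0,T]\to\ell^2$ with measurable coordinates $w_i:[0,T]\to\mathbb R^{d_i}$ such that $\sum_{i=1}^\infty\int_0^T\|w_i(s)\|^2\,ds\le\theta^2$. Solution: solutions are sought in the space $\mathcal C([0,T];\ell^2)$ of continuous functions $x:[0,T]\to\ell^2$ such that the coordinates $x_i(\cdot)$ are almost everywhere differentiable; a solution is such a function satisfying the differential equations (where the derivatives exist, i.e. almost everywhere) and the initial conditions.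
   Formalization: Solutions are additionally required to have absolutely continuous coordinates; with coordinates only continuous and almost everywhere differentiable, uniqueness fails (add e^{tA_1}c(t)v with c the Cantor function to the first component). *)

theory Defs
  imports
    "HOL-Analysis.Analysis"
    "Jordan_Normal_Form.Jordan_Normal_Form"
    "Jordan_Normal_Form.Char_Poly"
begin

hide_type (open) Finite_Cartesian_Product.vec
hide_const (open) Finite_Cartesian_Product.vec Finite_Cartesian_Product.mat

no_notation vec_nth (infixl "$" 90)

definition vec_norm2 :: "'a::real_normed_field vec \<Rightarrow> real" where
  "vec_norm2 v = L2_set (\<lambda>j. norm (v $ j)) {..<dim_vec v}"

definition mat_opnorm :: "'a::real_normed_field mat \<Rightarrow> real" where
  "mat_opnorm M = (SUP v \<in> {v \<in> carrier_vec (dim_col M). vec_norm2 v \<le> 1}. vec_norm2 (M *\<^sub>v v))"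

definition mat_exp :: "real mat \<Rightarrow> real mat" where
  "mat_exp M = mat (dim_row M) (dim_row M) (\<lambda>(j, k). \<Sum>m. (M ^\<^sub>m m) $$ (j, k) / fact m)"

abbreviation cmat :: "real mat \<Rightarrow> complex mat" where
  "cmat \<equiv> map_mat complex_of_real"

text \<open>The matrices \<open>A i\<close> are real, but their eigenvalues and hence their Jordan normal forms are
  in general complex; the transformations \<open>P i\<close> are complex as well.  Below, \<open>Q\<close> is the inverse of
  \<open>P i\<close> and \<open>P i * A i * Q\<close> is the Jordan matrix with blocks given by \<open>js\<close>.\<close>

definition uniformly_normalizable :: "(nat \<Rightarrow> real mat) \<Rightarrow> bool" where
  "uniformly_normalizable A \<longleftrightarrow>
    (\<exists>(P :: nat \<Rightarrow> complex mat) C. 1 \<le> C \<and>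
      (\<forall>i. \<exists>Q js. 0 \<notin> fst ` set js \<and> similar_mat_wit (jordan_matrix js) (cmat (A i)) (P i) Q \<and>
        mat_opnorm (P i) * mat_opnorm Q \<le> C))"

text \<open>In all of the following, \<open>d i\<close> is the dimension of the \<open>i\<close>-th component; components are
  numbered from \<open>0\<close>.\<close>

definition ell2 :: "(nat \<Rightarrow> nat) \<Rightarrow> (nat \<Rightarrow> real vec) set" where
  "ell2 d = {x. (\<forall>i. x i \<in> carrier_vec (d i)) \<and> summable (\<lambda>i. (vec_norm2 (x i))\<^sup>2)}"

definition ell2_dist :: "(nat \<Rightarrow> real vec) \<Rightarrow> (nat \<Rightarrow> real vec) \<Rightarrow> real" where
  "ell2_dist x y = sqrt (\<Sum>i. (vec_norm2 (x i - y i))\<^sup>2)"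

definition admissible_controls ::
    "(nat \<Rightarrow> nat) \<Rightarrow> real \<Rightarrow> real \<Rightarrow> (real \<Rightarrow> nat \<Rightarrow> real vec) set" where
  "admissible_controls d T \<theta> =
    {w. w \<in> {0..T} \<rightarrow> ell2 d \<and>
        (\<forall>i. \<forall>j<d i. (\<lambda>s. w s i $ j) \<in> borel_measurable (lebesgue_on {0..T})) \<and>
        (\<Sum>i. \<integral>\<^sup>+ s. ennreal ((vec_norm2 (w s i))\<^sup>2) \<partial>lebesgue_on {0..T}) \<le> ennreal (\<theta>\<^sup>2)}"

text \<open>The space \<open>C([0,T]; ell2)\<close>; its elements are made \<open>undefined\<close> outside \<open>[0,T]\<close>, so that
  equality of two elements means equality on \<open>[0,T]\<close>.\<close>

definition continuous_ell2 :: "(nat \<Rightarrow> nat) \<Rightarrow> real \<Rightarrow> (real \<Rightarrow> nat \<Rightarrow> real vec) set" where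
  "continuous_ell2 d T =
    {x \<in> {0..T} \<rightarrow>\<^sub>E ell2 d.
      \<forall>t\<in>{0..T}. ((\<lambda>s. ell2_dist (x s) (x t)) \<longlongrightarrow> 0) (at t within {0..T})}"

definition abs_continuous_on_interval :: "real \<Rightarrow> real \<Rightarrow> (real \<Rightarrow> real) \<Rightarrow> bool" where
  "abs_continuous_on_interval a b f \<longleftrightarrow>
    (\<forall>\<epsilon>>0. \<exists>\<delta>>0. \<forall>(n::nat) u v.
      (\<forall>k<n. a \<le> u k \<and> u k \<le> v k \<and> v k \<le> b) \<and>
      disjoint_family_on (\<lambda>k. {u k<..<v k}) {..<n} \<and>
      (\<Sum>k<n. v k - u k) < \<delta> \<longrightarrow>
      (\<Sum>k<n. \<bar>f (v k) - f (u k)\<bar>) < \<epsilon>)"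

text \<open>Almost everywhere differentiability of the coordinates is understood in the sense of
  Caratheodory solutions: the coordinates are absolutely continuous.  For merely continuous and
  almost everywhere differentiable coordinates, uniqueness fails: with \<open>c\<close> the Cantor function,
  \<open>t \<mapsto> mat_exp (t \<cdot>\<^sub>m A) *\<^sub>v (c t \<cdot>\<^sub>v v)\<close> starts at \<open>0\<close> and satisfies \<open>x' = A x\<close>
  almost everywhere.\<close>

definition is_solution ::
    "(nat \<Rightarrow> nat) \<Rightarrow> real \<Rightarrow> (nat \<Rightarrow> real mat) \<Rightarrow> (real \<Rightarrow> nat \<Rightarrow> real vec) \<Rightarrow> (nat \<Rightarrow> real vec) \<Rightarrow>
      (real \<Rightarrow> nat \<Rightarrow> real vec) \<Rightarrow> bool" where
  "is_solution d T A w x0 x \<longleftrightarrow>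
    x \<in> continuous_ell2 d T \<and>
    (\<forall>i. \<forall>j<d i. abs_continuous_on_interval 0 T (\<lambda>t. x t i $ j)) \<and>
    (\<forall>i. AE t in lebesgue_on {0..T}. \<forall>j<d i.
      ((\<lambda>s. x s i $ j) has_real_derivative (A i *\<^sub>v x t i + w t i) $ j) (at t within {0..T})) \<and>
    (\<forall>i. x 0 i = x0 i)"

text \<open>Componentwise integrals of vector-valued functions, defined on \<open>[a,b]\<close>.\<close>

definition vec_integrable :: "nat \<Rightarrow> real \<Rightarrow> real \<Rightarrow> (real \<Rightarrow> real vec) \<Rightarrow> bool" where
  "vec_integrable n a b f \<longleftrightarrow> (\<forall>j<n. integrable (lebesgue_on {a..b}) (\<lambda>s. f s $ j))"

definition vec_integral :: "nat \<Rightarrow> real \<Rightarrow> real \<Rightarrow> (real \<Rightarrow> real vec) \<Rightarrow> real vec" where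
  "vec_integral n a b f = vec n (\<lambda>j. \<integral>s. f s $ j \<partial>lebesgue_on {a..b})"

end

theory Submission
  imports Defs
begin

text \<open>
  For uniqueness, multiplying the difference of two solutions by \<open>exp (- t A\<^sub>i)\<close> gives an absolutely
  continuous function with zero derivative almost everywhere, hence a constant.  For existence, the
  variation-of-constants formula factors as \<open>exp (t A\<^sub>i) * (x\<^sub>i\<^sub>0 + \<integral>\<^sub>0\<^sup>t exp (- s A\<^sub>i) w\<^sub>i ds)\<close>, so the
  Lebesgue differentiation theorem applies to the integral.  Since the eigenvalues have
  nonpositive real part and \<open>d\<^sub>i \<le> D\<close>, the entries of \<open>exp (t J\<^sub>i)\<close> are at most \<open>exp T\<close> for Jordan
  matrices \<open>J\<^sub>i\<close>, so \<open>exp (t A\<^sub>i)\<close> is bounded by \<open>K = C D\<^sup>2 exp T\<close> uniformly in \<open>i\<close> and \<open>t \<in> [0,T]\<close>.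
  The squared norms of the components are therefore dominated by a summable sequence, which gives
  membership in \<open>\<ell>\<^sup>2\<close> and continuity.
\<close>

section \<open>Absolutely continuous functions\<close>

text \<open>Negative real parts alone give no bound uniform in i, since a far from normal matrix can
  have large transients. The bound C on the condition numbers rules this out, even when the
  transforming matrices themselves are unbounded. The powers of t produced by nontrivial Jordan
  blocks are absorbed by t^p / p! <= exp t, and the factor D^2 is the price of passing from entries
  to norms. The matrices of the family may be unbounded, so the exponentials at negative times that
  occur in the factorization have no uniform bound. The factorization therefore serves only the
  regularity of one component at a time. The uniform estimate is made on the unfactored kernel at
  the times t - s with 0 <= s <= t, which are nonnegative; Cauchy-Schwarz on [0,T] then turns the
  integral into the square integral of the control component, whose sum over i is finite by
  admissibility.\<close>

lemma abs_continuous_finite_family: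
  assumes "abs_continuous_on_interval a b f" "0 < \<epsilon>"
  shows "\<exists>\<delta>>0. \<forall>(I :: 'i set) u v. finite I \<longrightarrow>
      (\<forall>k\<in>I. a \<le> u k \<and> u k \<le> v k \<and> v k \<le> b) \<longrightarrow>
      disjoint_family_on (\<lambda>k. {u k<..<v k}) I \<longrightarrow> (\<Sum>k\<in>I. v k - u k) < \<delta> \<longrightarrow>
      (\<Sum>k\<in>I. \<bar>f (v k) - f (u k)\<bar>) < \<epsilon>"
proof -
  obtain \<delta> where "\<delta> > 0" and \<delta>: "\<And>(n::nat) u v.
      (\<forall>k<n. a \<le> u k \<and> u k \<le> v k \<and> v k \<le> b) \<Longrightarrow>
      disjoint_family_on (\<lambda>k. {u k<..<v k}) {..<n} \<Longrightarrow>
      (\<Sum>k<n. v k - u k) < \<delta> \<Longrightarrow> (\<Sum>k<n. \<bar>f (v k) - f (u k)\<bar>) < \<epsilon>"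
    using assms unfolding abs_continuous_on_interval_def by meson
  show ?thesis
  proof (intro exI[of _ \<delta>] conjI allI impI \<open>\<delta> > 0\<close>)
    fix I :: "'i set" and u v
    assume "finite I" and uv: "\<forall>k\<in>I. a \<le> u k \<and> u k \<le> v k \<and> v k \<le> b"
      and disj: "disjoint_family_on (\<lambda>k. {u k<..<v k}) I" and less: "(\<Sum>k\<in>I. v k - u k) < \<delta>"
    \<comment> \<open>Arbitrary index types matter because the intervals of a tagged division are
      indexed by pairs of a point and a set; an enumeration leads back to initial segments of the
      naturals.\<close>
    obtain h where h: "bij_betw h {..<card I} I"
      using ex_bij_betw_nat_finite[OF \<open>finite I\<close>] by (auto simp: atLeast0LessThan)
    note eq = sum.reindex_bij_betw[OF h, symmetric]
    have "disjoint_family_on (\<lambda>k. {u (h k)<..<v (h k)}) {..<card I}"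
      using disj h unfolding disjoint_family_on_def bij_betw_def
      by (metis image_eqI inj_on_eq_iff)
    then show "(\<Sum>k\<in>I. \<bar>f (v k) - f (u k)\<bar>) < \<epsilon>"
      using \<delta>[of "card I" "\<lambda>k. u (h k)" "\<lambda>k. v (h k)"] uv less bij_betw_apply[OF h]
      by (simp add: eq)
  qed
qed

lemma sum_lengths_le_measure:
  fixes u v :: "'i \<Rightarrow> real"
  assumes "finite I" "\<And>k. k \<in> I \<Longrightarrow> u k \<le> v k" "disjoint_family_on (\<lambda>k. {u k<..<v k}) I"
    and "\<And>k. k \<in> I \<Longrightarrow> {u k<..<v k} \<subseteq> U" "U \<in> lmeasurable"
  shows "(\<Sum>k\<in>I. v k - u k) \<le> measure lebesgue U"
proof -
  have "(\<Sum>k\<in>I. v k - u k) = (\<Sum>k\<in>I. measure lebesgue {u k<..<v k})"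
    using assms(2) by (intro sum.cong) auto
  also have "\<dots> = measure lebesgue (\<Union>k\<in>I. {u k<..<v k})"
    using assms(1,3) by (intro measure_finite_Union[symmetric]) (auto simp: emeasure_lborel_Ioo assms(2))
  also have "\<dots> \<le> measure lebesgue U"
    using assms by (intro measure_mono_fmeasurable) auto
  finally show ?thesis .
qed

text \<open>A Cousin-type argument: a fine tagged division controls the increments at points where the
  derivative vanishes by differentiability, and the remaining ones by absolute continuity.\<close>

lemma abs_continuous_zero_derivative_const:
  assumes ac: "abs_continuous_on_interval a b f"
    and der: "AE t in lebesgue_on {a..b}. (f has_real_derivative 0) (at t within {a..b})"
    and t: "t \<in> {a..b}"
  shows "f t = f a"
proof -
  define N where "N = {s\<in>{a..b}. \<not> (f has_real_derivative 0) (at s within {a..b})}"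
  have "AE s in lebesgue. s \<in> {a..b} \<longrightarrow> (f has_real_derivative 0) (at s within {a..b})"
    using der by (subst (asm) AE_restrict_space_iff) auto
  then have "N \<in> null_sets lebesgue"
    by (auto simp: N_def completion.AE_iff_null_sets)
  then have N: "N \<in> sets lebesgue" "emeasure lebesgue N = 0" by auto
  \<comment> \<open>The share \<open>e * (t - a)\<close> comes from the tags where the derivative is
    0, the additional \<open>e\<close> from the tags in \<open>N\<close>.\<close>
  have "\<bar>f t - f a\<bar> \<le> e * (t - a + 1)" if "e > 0" for e
  proof -
    obtain \<delta> where "\<delta> > 0" and \<delta>: "\<forall>(I :: (real \<times> real set) set) u v. finite I \<longrightarrow>
      (\<forall>k\<in>I. a \<le> u k \<and> u k \<le> v k \<and> v k \<le> b) \<longrightarrow>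
      disjoint_family_on (\<lambda>k. {u k<..<v k}) I \<longrightarrow> (\<Sum>k\<in>I. v k - u k) < \<delta> \<longrightarrow>
      (\<Sum>k\<in>I. \<bar>f (v k) - f (u k)\<bar>) < e"
      using abs_continuous_finite_family[OF ac \<open>e > 0\<close>] by blast
    obtain U where U: "open U" "N \<subseteq> U" "U - N \<in> lmeasurable" "emeasure lebesgue (U - N) < ennreal \<delta>"
      using sets_lebesgue_outer_open[OF N(1) \<open>\<delta> > 0\<close>] .
    have "N \<in> lmeasurable"
      using N by (auto intro!: fmeasurableI)
    moreover have "U = (U - N) \<union> N"
      using U(2) by blast
    ultimately have Ulm: "U \<in> lmeasurable"
      using U(3) by (metis fmeasurable.Un)
    \<comment> \<open>The outer approximation only controls \<open>U - N\<close>; as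
      \<open>N\<close> is null, \<open>U\<close> is equally small.\<close>
    have "emeasure lebesgue U = emeasure lebesgue (U - N)"
      using emeasure_Diff_null_set[of N lebesgue U] N Ulm by (auto simp: null_sets_def)
    then have mU: "measure lebesgue U < \<delta>"
      using U(4) Ulm \<open>\<delta> > 0\<close> by (metis emeasure_eq_measure2 ennreal_less_iff measure_nonneg)
    have "\<exists>r>0. \<forall>y\<in>{a..b}. \<bar>y - s\<bar> < r \<longrightarrow> \<bar>f y - f s\<bar> \<le> e * \<bar>y - s\<bar>" if "s \<in> {a..b} - N" for s
    proof -
      have "(f has_derivative (*) 0) (at s within {a..b})"
        using that by (auto simp: N_def has_field_derivative_def)
      from this[unfolded has_derivative_within_alt] \<open>e > 0\<close>
      show ?thesis by auto
    qed
    then obtain r where r: "\<And>s. s \<in> {a..b} - N \<Longrightarrow> 0 < r s"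
      "\<And>s y. s \<in> {a..b} - N \<Longrightarrow> y \<in> {a..b} \<Longrightarrow> \<bar>y - s\<bar> < r s \<Longrightarrow> \<bar>f y - f s\<bar> \<le> e * \<bar>y - s\<bar>"
      by metis
    \<comment> \<open>Intervals tagged in \<open>N\<close> are forced into \<open>U\<close>, so
      their total length stays below \<delta>; the other tags in {a..b} get a ball on which the
      differentiability estimate holds. The radius 1 outside {a..b} is arbitrary and only makes
      \<gamma> a gauge on the whole line.\<close>
    define \<gamma> where "\<gamma> s = (if s \<in> N then U else if s \<in> {a..b} then ball s (r s) else ball s 1)" for s
    have "gauge \<gamma>"
      using U r by (auto simp: gauge_def \<gamma>_def)
    then obtain p where p: "p tagged_division_of {a..t}" "\<gamma> fine p"
      using fine_division_exists_real by blast
    have finp: "finite p" using p by auto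
    have pD: "s \<in> K" "K \<subseteq> {a..t}" "K = {Inf K..Sup K}" "a \<le> Inf K" "Inf K \<le> s" "s \<le> Sup K" "Sup K \<le> b"
      "K \<subseteq> \<gamma> s" if pK: "(s, K) \<in> p" for s K
    proof -
      show 1: "s \<in> K" "K \<subseteq> {a..t}" using tagged_division_ofD(2,3)[OF p(1) pK] .
      obtain c d where "K = cbox c d" using tagged_division_ofD(4)[OF p(1) pK] by auto
      with 1 have K: "K = {c..d}" "c \<le> d" by auto
      then have "Inf K = c" "Sup K = d" by auto
      then show "K = {Inf K..Sup K}" "a \<le> Inf K" "Inf K \<le> s" "s \<le> Sup K" "Sup K \<le> b"
        using 1 K t by auto
      show "K \<subseteq> \<gamma> s" using p(2) pK by (auto simp: fine_def)
    qed
    define I where "I = {x\<in>p. fst x \<in> N}"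
    let ?u = "\<lambda>x::real \<times> real set. Inf (snd x)" and ?v = "\<lambda>x::real \<times> real set. Sup (snd x)"
    have disj: "disjoint_family_on (\<lambda>k. {?u k<..<?v k}) p"
      unfolding disjoint_family_on_def
    proof (intro ballI impI)
      fix x y assume xy: "x \<in> p" "y \<in> p" "x \<noteq> y"
      then have "interior (snd x) \<inter> interior (snd y) = {}"
        using tagged_division_ofD(5)[OF p(1), of "fst x" "snd x" "fst y" "snd y"] by auto
      moreover have "interior (snd z) = {?u z<..<?v z}" if "z \<in> p" for z
        using pD(3)[of "fst z" "snd z"] that by (metis interior_atLeastAtMost_real prod.collapse)
      ultimately show "{?u x<..<?v x} \<inter> {?u y<..<?v y} = {}" using xy by auto
    qed
    then have disjI: "disjoint_family_on (\<lambda>k. {?u k<..<?v k}) I"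
      by (rule disjoint_family_on_mono[rotated]) (auto simp: I_def)
    have ord: "?u x \<le> ?v x" "a \<le> ?u x" "?v x \<le> b" if "x \<in> p" for x
      using pD[of "fst x" "snd x"] that by auto
    have "(\<Sum>k\<in>I. ?v k - ?u k) \<le> measure lebesgue U"
    proof (rule sum_lengths_le_measure[OF _ _ disjI _ Ulm])
      fix k assume k: "k \<in> I"
      then have "snd k \<subseteq> U"
        using pD(8)[of "fst k" "snd k"] by (auto simp: I_def \<gamma>_def)
      moreover have "{?u k<..<?v k} \<subseteq> snd k"
        using pD(3)[of "fst k" "snd k"] k unfolding I_def
        by (metis (no_types, lifting) greaterThanLessThan_subseteq_atLeastAtMost_iff mem_Collect_eq order_refl prod.collapse)
      ultimately show "{?u k<..<?v k} \<subseteq> U" by blast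
    qed (use finp ord in \<open>auto simp: I_def\<close>)
    then have 1: "(\<Sum>k\<in>I. \<bar>f (?v k) - f (?u k)\<bar>) < e"
      using mU finp ord by (intro \<delta>[rule_format, OF _ _ disjI]) (auto simp: I_def)
    have "(\<Sum>k\<in>p - I. \<bar>f (?v k) - f (?u k)\<bar>) \<le> (\<Sum>k\<in>p - I. e * (?v k - ?u k))"
    proof (rule sum_mono)
      fix k assume k: "k \<in> p - I"
      obtain s K where sK: "k = (s, K)" by force
      note D = pD[of s K]
      have s: "s \<in> {a..b} - N" using k D t sK by (auto simp: I_def)
      have ends: "Inf K \<in> K" "Sup K \<in> K"
        using D k sK by (metis DiffD1 atLeastAtMost_iff order.trans order_refl)+
      then have "\<bar>Inf K - s\<bar> < r s" "\<bar>Sup K - s\<bar> < r s"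
        using D(8) k sK s subsetD[OF _ ends(1), of "\<gamma> s"] subsetD[OF _ ends(2), of "\<gamma> s"]
        by (auto simp: \<gamma>_def dist_real_def abs_minus_commute)
      then have "\<bar>f (Inf K) - f s\<bar> \<le> e * \<bar>Inf K - s\<bar>" "\<bar>f (Sup K) - f s\<bar> \<le> e * \<bar>Sup K - s\<bar>"
        using r(2)[OF s, of "Inf K"] r(2)[OF s, of "Sup K"] D(4-7) k sK \<open>\<bar>Inf K - s\<bar> < r s\<close> by auto
      moreover have "\<bar>Inf K - s\<bar> = s - Inf K" "\<bar>Sup K - s\<bar> = Sup K - s"
        using D k sK by auto
      ultimately have "\<bar>f (Inf K) - f s\<bar> \<le> e * (s - Inf K)" "\<bar>f (Sup K) - f s\<bar> \<le> e * (Sup K - s)"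
        by simp_all
      \<comment> \<open>The derivative estimate has one point fixed at the tag, so the increment is
        split there. Since the tag lies between the endpoints, the two distances add up exactly to
        the length.\<close>
      then have "\<bar>f (Sup K) - f (Inf K)\<bar> \<le> e * (s - Inf K) + e * (Sup K - s)" by arith
      then show "\<bar>f (?v k) - f (?u k)\<bar> \<le> e * (?v k - ?u k)"
        using sK by (simp add: algebra_simps)
    qed
    also have "\<dots> \<le> (\<Sum>k\<in>p. e * (?v k - ?u k))"
      using finp ord \<open>e > 0\<close> by (intro sum_mono2) auto
    also have "\<dots> = e * (t - a)"
      using additive_tagged_division_1[OF _ p(1), of "\<lambda>x. x"] t
      by (simp add: sum_distrib_left[symmetric] case_prod_unfold)
    finally have 2: "(\<Sum>k\<in>p - I. \<bar>f (?v k) - f (?u k)\<bar>) \<le> e * (t - a)" .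
    have "f t - f a = (\<Sum>k\<in>p. f (?v k) - f (?u k))"
      using additive_tagged_division_1[OF _ p(1), of f] t by (simp add: case_prod_unfold)
    then have "\<bar>f t - f a\<bar> \<le> (\<Sum>k\<in>p. \<bar>f (?v k) - f (?u k)\<bar>)"
      by (simp add: sum_abs)
    also have "\<dots> = (\<Sum>k\<in>p - I. \<bar>f (?v k) - f (?u k)\<bar>) + (\<Sum>k\<in>I. \<bar>f (?v k) - f (?u k)\<bar>)"
      using finp by (intro sum.subset_diff) (auto simp: I_def)
    also have "\<dots> \<le> e * (t - a + 1)"
      using 1 2 by (simp add: algebra_simps)
    finally show ?thesis .
  qed
  note bound = this
  have "\<bar>f t - f a\<bar> \<le> 0 + e" if "e > 0" for e
  proof -
    have "t - a + 1 > 0" using t by auto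
    then show ?thesis using bound[of "e / (t - a + 1)"] that by simp
  qed
  then have "\<bar>f t - f a\<bar> \<le> 0"
    by (rule field_le_epsilon)
  then show ?thesis by simp
qed

text \<open>Elements of \<open>continuous_ell2\<close> are \<open>undefined\<close> outside [0,T]
  and \<open>sol_entry\<close> holds only up to T, so the property has to be transferred along
  equality on the interval alone.\<close>

lemma abs_continuous_cong:
  assumes "\<And>t. t \<in> {a..b} \<Longrightarrow> f t = g t"
  shows "abs_continuous_on_interval a b f \<longleftrightarrow> abs_continuous_on_interval a b g"
proof -
  have "abs_continuous_on_interval a b g" if ac: "abs_continuous_on_interval a b f"
    and eq: "\<And>t. t \<in> {a..b} \<Longrightarrow> f t = g t" for f g
    unfolding abs_continuous_on_interval_def
  proof (intro allI impI)
    fix e :: real assume "e > 0"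
    obtain \<delta> where \<delta>: "\<delta> > 0" "\<forall>(I :: nat set) u v. finite I \<longrightarrow>
      (\<forall>k\<in>I. a \<le> u k \<and> u k \<le> v k \<and> v k \<le> b) \<longrightarrow>
      disjoint_family_on (\<lambda>k. {u k<..<v k}) I \<longrightarrow> (\<Sum>k\<in>I. v k - u k) < \<delta> \<longrightarrow>
      (\<Sum>k\<in>I. \<bar>f (v k) - f (u k)\<bar>) < e"
      using abs_continuous_finite_family[OF ac \<open>e > 0\<close>] by blast
    have "(\<Sum>k<n. \<bar>g (v k) - g (u k)\<bar>) < e"
      if H: "\<forall>k<n. a \<le> u k \<and> u k \<le> v k \<and> v k \<le> b"
        "disjoint_family_on (\<lambda>k. {u k<..<v k}) {..<n}" "(\<Sum>k<n. v k - u k) < \<delta>" for n :: nat and u v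
    proof -
      have "f (v k) - f (u k) = g (v k) - g (u k)" if "k < n" for k
        using H(1) that \<open>\<And>t. t \<in> {a..b} \<Longrightarrow> f t = g t\<close>
        by (metis atLeastAtMost_iff order.trans)
      then have "(\<Sum>k<n. \<bar>f (v k) - f (u k)\<bar>) = (\<Sum>k<n. \<bar>g (v k) - g (u k)\<bar>)"
        by (intro sum.cong) auto
      moreover have "(\<Sum>k<n. \<bar>f (v k) - f (u k)\<bar>) < e"
        using H by (intro \<delta>(2)[rule_format]) auto
      ultimately show ?thesis by simp
    qed
    with \<open>\<delta> > 0\<close> show "\<exists>\<delta>>0. \<forall>(n::nat) u v. (\<forall>k<n. a \<le> u k \<and> u k \<le> v k \<and> v k \<le> b) \<and>
      disjoint_family_on (\<lambda>k. {u k<..<v k}) {..<n} \<and> (\<Sum>k<n. v k - u k) < \<delta> \<longrightarrow>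
      (\<Sum>k<n. \<bar>g (v k) - g (u k)\<bar>) < e" by blast
  qed
  from this[of f g] this[of g f] assms show ?thesis by auto
qed

text \<open>Sums, products and Lipschitz functions are all handled by comparing increments.\<close>

lemma abs_continuous_dominated:
  assumes f: "abs_continuous_on_interval a b f" and g: "abs_continuous_on_interval a b g"
    and M: "0 < M" "\<And>u v. a \<le> u \<Longrightarrow> u \<le> v \<Longrightarrow> v \<le> b \<Longrightarrow>
      \<bar>h v - h u\<bar> \<le> M * (\<bar>f v - f u\<bar> + \<bar>g v - g u\<bar> + (v - u))"
  shows "abs_continuous_on_interval a b h"
  unfolding abs_continuous_on_interval_def
proof (intro allI impI)
  fix e :: real assume "e > 0"
  \<comment> \<open>Each of the three sums in the majorant gets a third of e / M. The third sum is
    the total length itself, which is why \<open>e'\<close> also enters the minimum below.\<close>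
  define e' where "e' = e / (3 * M)"
  have "e' > 0" using \<open>e > 0\<close> M by (simp add: e'_def)
  obtain \<delta> where \<delta>: "\<delta> > 0" "\<forall>(I :: nat set) u v. finite I \<longrightarrow>
      (\<forall>k\<in>I. a \<le> u k \<and> u k \<le> v k \<and> v k \<le> b) \<longrightarrow>
      disjoint_family_on (\<lambda>k. {u k<..<v k}) I \<longrightarrow> (\<Sum>k\<in>I. v k - u k) < \<delta> \<longrightarrow>
      (\<Sum>k\<in>I. \<bar>f (v k) - f (u k)\<bar>) < e'"
    using abs_continuous_finite_family[OF f \<open>e' > 0\<close>] by blast
  obtain \<delta>' where \<delta>': "\<delta>' > 0" "\<forall>(I :: nat set) u v. finite I \<longrightarrow>
      (\<forall>k\<in>I. a \<le> u k \<and> u k \<le> v k \<and> v k \<le> b) \<longrightarrow>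
      disjoint_family_on (\<lambda>k. {u k<..<v k}) I \<longrightarrow> (\<Sum>k\<in>I. v k - u k) < \<delta>' \<longrightarrow>
      (\<Sum>k\<in>I. \<bar>g (v k) - g (u k)\<bar>) < e'"
    using abs_continuous_finite_family[OF g \<open>e' > 0\<close>] by blast
  show "\<exists>\<delta>>0. \<forall>(n::nat) u v. (\<forall>k<n. a \<le> u k \<and> u k \<le> v k \<and> v k \<le> b) \<and>
      disjoint_family_on (\<lambda>k. {u k<..<v k}) {..<n} \<and> (\<Sum>k<n. v k - u k) < \<delta> \<longrightarrow>
      (\<Sum>k<n. \<bar>h (v k) - h (u k)\<bar>) < e"
  proof (intro exI[of _ "min (min \<delta> \<delta>') e'"] conjI allI impI; (elim conjE)?)
    fix n :: nat and u v
    assume H: "\<forall>k<n. a \<le> u k \<and> u k \<le> v k \<and> v k \<le> b"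
      "disjoint_family_on (\<lambda>k. {u k<..<v k}) {..<n}" "(\<Sum>k<n. v k - u k) < min (min \<delta> \<delta>') e'"
    have "(\<Sum>k<n. \<bar>h (v k) - h (u k)\<bar>) \<le>
        (\<Sum>k<n. M * (\<bar>f (v k) - f (u k)\<bar> + \<bar>g (v k) - g (u k)\<bar> + (v k - u k)))"
      using H by (intro sum_mono M) auto
    also have "\<dots> = M * ((\<Sum>k<n. \<bar>f (v k) - f (u k)\<bar>) + (\<Sum>k<n. \<bar>g (v k) - g (u k)\<bar>) + (\<Sum>k<n. v k - u k))"
      by (simp add: sum.distrib sum_distrib_left[symmetric])
    also have "\<dots> < M * (e' + e' + e')"
      using H \<delta>(2)[rule_format, of "{..<n}" u v] \<delta>'(2)[rule_format, of "{..<n}" u v]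
      by (intro mult_strict_left_mono[OF _ M(1)] add_strict_mono) auto
    also have "\<dots> = e" using M by (simp add: e'_def)
    finally show "(\<Sum>k<n. \<bar>h (v k) - h (u k)\<bar>) < e" .
  qed (use \<delta> \<delta>' \<open>e' > 0\<close> in auto)
qed

lemma abs_continuous_const: "abs_continuous_on_interval a b (\<lambda>_. c)"
  by (auto simp: abs_continuous_on_interval_def intro: exI[of _ 1])

lemma abs_continuous_add:
  "abs_continuous_on_interval a b f \<Longrightarrow> abs_continuous_on_interval a b g \<Longrightarrow>
    abs_continuous_on_interval a b (\<lambda>t. f t + g t)"
  by (erule (1) abs_continuous_dominated[where M = 1]) auto

lemma abs_continuous_sum:
  "(\<And>k. k \<in> I \<Longrightarrow> abs_continuous_on_interval a b (f k)) \<Longrightarrow>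
    abs_continuous_on_interval a b (\<lambda>t. \<Sum>k\<in>I. f k t)"
  by (induction I rule: infinite_finite_induct)
    (auto intro: abs_continuous_const abs_continuous_add)

lemma abs_continuous_imp_continuous_on:
  assumes "abs_continuous_on_interval a b f"
  shows "continuous_on {a..b} f"
  unfolding continuous_on_iff
proof (intro ballI allI impI)
  fix x e :: real assume x: "x \<in> {a..b}" and "e > 0"
  obtain \<delta> where \<delta>: "\<delta> > 0" "\<forall>(I :: nat set) u v. finite I \<longrightarrow>
      (\<forall>k\<in>I. a \<le> u k \<and> u k \<le> v k \<and> v k \<le> b) \<longrightarrow>
      disjoint_family_on (\<lambda>k. {u k<..<v k}) I \<longrightarrow> (\<Sum>k\<in>I. v k - u k) < \<delta> \<longrightarrow>
      (\<Sum>k\<in>I. \<bar>f (v k) - f (u k)\<bar>) < e"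
    using abs_continuous_finite_family[OF assms \<open>e > 0\<close>] by blast
  have *: "\<bar>f y - f x\<bar> < e" if "a \<le> x" "x \<le> y" "y \<le> b" "y - x < \<delta>" for x y
    using \<delta>(2)[rule_format, of "{0}" "\<lambda>_. x" "\<lambda>_. y"] that by (auto simp: disjoint_family_on_def)
  have "dist (f y) (f x) < e" if "y \<in> {a..b}" "dist y x < \<delta>" for y
    using *[of x y] *[of y x] x that by (cases "x \<le> y") (auto simp: dist_real_def abs_minus_commute)
  with \<open>\<delta> > 0\<close> show "\<exists>d>0. \<forall>x'\<in>{a..b}. dist x' x < d \<longrightarrow> dist (f x') (f x) < e" by blast
qed

lemma abs_continuous_mult:
  assumes f: "abs_continuous_on_interval a b f" and g: "abs_continuous_on_interval a b g"
  shows "abs_continuous_on_interval a b (\<lambda>t. f t * g t)"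
proof -
  have "\<exists>B. \<forall>t\<in>{a..b}. \<bar>h t\<bar> \<le> B" if "abs_continuous_on_interval a b h" for h
    using compact_continuous_image[OF abs_continuous_imp_continuous_on[OF that]]
    by (force dest!: compact_imp_bounded simp: bounded_iff)
  with f g obtain B C where B: "\<And>t. t \<in> {a..b} \<Longrightarrow> \<bar>f t\<bar> \<le> B" and C: "\<And>t. t \<in> {a..b} \<Longrightarrow> \<bar>g t\<bar> \<le> C"
    by meson
  \<comment> \<open>The absolute values and the added 1 guarantee the positivity that the domination
    lemma asks for.\<close>
  define M where "M = \<bar>B\<bar> + \<bar>C\<bar> + 1"
  have "M > 0" by (simp add: M_def)
  show ?thesis
  proof (rule abs_continuous_dominated[OF f g \<open>M > 0\<close>])
    fix u v :: real assume uv: "a \<le> u" "u \<le> v" "v \<le> b"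
    have "f v * g v - f u * g u = g v * (f v - f u) + f u * (g v - g u)" by (simp add: algebra_simps)
    then have "\<bar>f v * g v - f u * g u\<bar> \<le> \<bar>g v\<bar> * \<bar>f v - f u\<bar> + \<bar>f u\<bar> * \<bar>g v - g u\<bar>"
      by (metis abs_mult abs_triangle_ineq)
    also have "\<dots> \<le> M * \<bar>f v - f u\<bar> + M * \<bar>g v - g u\<bar>"
      using B[of u] C[of v] uv by (intro add_mono mult_right_mono) (auto simp: M_def)
    also have "\<dots> \<le> M * (\<bar>f v - f u\<bar> + \<bar>g v - g u\<bar> + (v - u))"
      using mult_nonneg_nonneg[of M "v - u"] uv \<open>M > 0\<close> by (simp add: distrib_left)
    finally show "\<bar>f v * g v - f u * g u\<bar> \<le> M * (\<bar>f v - f u\<bar> + \<bar>g v - g u\<bar> + (v - u))" .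
  qed
qed

lemma abs_continuous_C1:
  assumes "\<And>t. t \<in> {a..b} \<Longrightarrow> (f has_real_derivative f' t) (at t)" "continuous_on {a..b} f'"
  shows "abs_continuous_on_interval a b f"
proof -
  obtain B where B: "\<And>t. t \<in> {a..b} \<Longrightarrow> \<bar>f' t\<bar> \<le> B"
    using compact_continuous_image[OF assms(2)] by (force dest!: compact_imp_bounded simp: bounded_iff)
  show ?thesis
  \<comment> \<open>With zero functions for both majorants only the length term remains, and
    domination becomes a Lipschitz bound, obtained from the mean value theorem.\<close>
  proof (rule abs_continuous_dominated[OF abs_continuous_const[of _ _ 0] abs_continuous_const[of _ _ 0]])
    fix u v :: real assume uv: "a \<le> u" "u \<le> v" "v \<le> b"
    have "\<bar>f v - f u\<bar> \<le> (\<bar>B\<bar> + 1) * (v - u)"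
    proof (cases "u = v")
      case False
      then obtain z where z: "u < z" "z < v" "f v - f u = (v - u) * f' z"
        using MVT2[of u v f f'] assms(1) uv by auto
      have "\<bar>f' z\<bar> \<le> \<bar>B\<bar> + 1" using B[of z] z uv by auto
      then show ?thesis using z uv by (simp add: abs_mult mult.commute mult_right_mono)
    qed auto
    then show "\<bar>f v - f u\<bar> \<le> (\<bar>B\<bar> + 1) * (\<bar>0 - 0\<bar> + \<bar>0 - 0\<bar> + (v - u))" by simp
  qed auto
qed

section \<open>Indefinite Lebesgue integrals\<close>

lemma integrable_lebesgue_on_subinterval:
  fixes h :: "real \<Rightarrow> real"
  assumes "integrable (lebesgue_on {a..b}) h" "a \<le> u" "v \<le> b"
  shows "integrable (lebesgue_on {u..v}) h"
proof -
  have "set_integrable lebesgue {a..b} h"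
    using assms(1) by (simp add: set_integrable_eq)
  then have "set_integrable lebesgue {u..v} h"
    by (rule set_integrable_subset) (use assms in auto)
  then show ?thesis by (simp add: set_integrable_eq)
qed

text \<open>A Lebesgue integrable function has the same Henstock-Kurzweil integral, which is
  additive over adjacent closed intervals. The right side is kept in that form because the
  differentiation theorem below is phrased with it.\<close>

lemma primitive_diff:
  fixes h :: "real \<Rightarrow> real"
  assumes h: "integrable (lebesgue_on {a..b}) h" and uv: "a \<le> u" "u \<le> v" "v \<le> b"
  shows "integral\<^sup>L (lebesgue_on {a..v}) h - integral\<^sup>L (lebesgue_on {a..u}) h = integral {u..v} h"
proof -
  have HK: "integral\<^sup>L (lebesgue_on {a..t}) h = integral {a..t} h" "h integrable_on {a..t}"
    if "t \<le> b" for t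
  proof -
    have "(h has_integral (integral\<^sup>L (lebesgue_on {a..t}) h)) {a..t}"
      by (intro has_integral_integral_lebesgue_on integrable_lebesgue_on_subinterval[OF h]) (use that in auto)
    then show "integral\<^sup>L (lebesgue_on {a..t}) h = integral {a..t} h" "h integrable_on {a..t}"
      by (auto simp: integral_unique has_integral_integrable)
  qed
  then show ?thesis
    using Henstock_Kurzweil_Integration.integral_combine[of a u v h] uv HK[of v] HK[of u] by simp
qed

text \<open>The integrand is split into a part bounded by \<open>n\<close> and a remainder of small integral.\<close>

lemma abs_continuous_primitive:
  fixes h :: "real \<Rightarrow> real"
  assumes h: "integrable (lebesgue_on {a..b}) h"
  shows "abs_continuous_on_interval a b (\<lambda>t. integral\<^sup>L (lebesgue_on {a..t}) h)"
  unfolding abs_continuous_on_interval_def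
proof (intro allI impI)
  fix e :: real assume "e > 0"
  define g where "g x = indicator {a..b} x * \<bar>h x\<bar>" for x
  have g: "integrable lebesgue g"
    using integrable_norm[OF h] by (simp add: integrable_restrict_space g_def[abs_def])
  have g0: "g x \<ge> 0" for x by (simp add: g_def)
  define r where "r n x = g x - min (g x) (real n)" for n x
  have r: "integrable lebesgue (r n)" for n
    unfolding r_def using g0
    by (intro Bochner_Integration.integrable_diff g Bochner_Integration.integrable_bound[OF g])
      (use g in \<open>auto intro!: AE_I2\<close>)
  have "(\<lambda>n. integral\<^sup>L lebesgue (r n)) \<longlonglongrightarrow> integral\<^sup>L lebesgue (\<lambda>x :: real. 0 :: real)"
  proof (rule integral_dominated_convergence[where w = g])
    show "integrable lebesgue g" by (fact g)
    show "r n \<in> borel_measurable lebesgue" for n using r by auto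
    have "eventually (\<lambda>n. r n x = 0) sequentially" for x
      using eventually_ge_at_top[of "nat \<lceil>g x\<rceil>"]
      by eventually_elim (simp add: r_def min_def nat_le_iff ceiling_le_iff)
    then show "AE x in lebesgue. (\<lambda>n. r n x) \<longlonglongrightarrow> 0"
      by (intro AE_I2 tendsto_eventually)
    show "AE x in lebesgue. norm (r n x) \<le> g x" for n
      using g0 by (intro AE_I2) (auto simp: r_def)
  qed auto
  then have "eventually (\<lambda>n. integral\<^sup>L lebesgue (r n) < e / 2) sequentially"
    by (rule order_tendstoD) (use \<open>e > 0\<close> in auto)
  then obtain n where n: "integral\<^sup>L lebesgue (r n) < e / 2"
    by (auto simp: eventually_sequentially)
  have r0: "r n x \<ge> 0" for x by (simp add: r_def)
  \<comment> \<open>Chosen so that n * \<delta> is at most e / 2; the added 1 keeps the denominator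
    positive for n = 0.\<close>
  define \<delta> where "\<delta> = e / (2 * (real n + 1))"
  have "\<delta> > 0" using \<open>e > 0\<close> by (simp add: \<delta>_def)
  have one: "\<bar>integral\<^sup>L (lebesgue_on {a..v}) h - integral\<^sup>L (lebesgue_on {a..u}) h\<bar> \<le>
      integral\<^sup>L lebesgue (\<lambda>x. indicator {u<..<v} x * r n x) + real n * (v - u)"
    if uv: "a \<le> u" "u \<le> v" "v \<le> b" for u v
  proof -
    have hu: "integrable (lebesgue_on {u..v}) h"
      using integrable_lebesgue_on_subinterval[OF h] uv by auto
    have "integral {u..v} h = integral\<^sup>L (lebesgue_on {u..v}) h"
      using has_integral_integral_lebesgue_on[OF hu] by (simp add: integral_unique)
    then have "\<bar>integral\<^sup>L (lebesgue_on {a..v}) h - integral\<^sup>L (lebesgue_on {a..u}) h\<bar>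
        = \<bar>integral\<^sup>L (lebesgue_on {u..v}) h\<bar>"
      using primitive_diff[OF h uv] by simp
    also have "\<dots> \<le> integral\<^sup>L (lebesgue_on {u..v}) (\<lambda>x. \<bar>h x\<bar>)"
      using integral_norm_bound[of "lebesgue_on {u..v}" h] by simp
    also have "\<dots> = integral\<^sup>L lebesgue (\<lambda>x. indicator {u..v} x * \<bar>h x\<bar>)"
      by (simp add: integral_restrict_space)
    \<comment> \<open>The disjointness hypothesis concerns open intervals, so the two endpoints, a
      null set, are dropped here.\<close>
    also have "\<dots> = integral\<^sup>L lebesgue (\<lambda>x. indicator {u<..<v} x * g x)"
    proof (rule integral_cong_AE)
      have "AE x in lebesgue. x \<noteq> c" for c :: real
        by (rule AE_I[where N="{c}"]) auto
      from this[of u] this[of v]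
      show "AE x in lebesgue. indicator {u..v} x * \<bar>h x\<bar> = indicator {u<..<v} x * g x"
        by eventually_elim (use uv in \<open>auto simp: g_def indicator_def\<close>)
      show "(\<lambda>x. indicator {u..v} x * \<bar>h x\<bar>) \<in> borel_measurable lebesgue"
        using integrable_norm[OF hu] by (simp add: integrable_restrict_space borel_measurable_integrable)
      show "(\<lambda>x. indicator {u<..<v} x * g x) \<in> borel_measurable lebesgue"
        using integrable_real_mult_indicator[OF _ g, of "{u<..<v}"]
        by (simp add: mult.commute borel_measurable_integrable)
    qed
    also have "\<dots> \<le> integral\<^sup>L lebesgue (\<lambda>x. indicator {u<..<v} x * r n x + real n * indicator {u<..<v} x)"
    proof (rule integral_mono)
      show "integrable lebesgue (\<lambda>x. indicator {u<..<v} x * g x)"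
        using integrable_real_mult_indicator[OF _ g, of "{u<..<v}"] by (simp add: mult.commute)
      show "integrable lebesgue (\<lambda>x. indicator {u<..<v} x * r n x + real n * indicator {u<..<v} x)"
        using integrable_real_mult_indicator[OF _ r, of "{u<..<v}" n]
        by (intro Bochner_Integration.integrable_add) (auto simp: mult.commute emeasure_lborel_Ioo uv)
      show "indicator {u<..<v} x * g x \<le> indicator {u<..<v} x * r n x + real n * indicator {u<..<v} x" for x
        by (auto simp: r_def indicator_def)
    qed
    also have "\<dots> = integral\<^sup>L lebesgue (\<lambda>x. indicator {u<..<v} x * r n x) + real n * (v - u)"
      using integrable_real_mult_indicator[OF _ r, of "{u<..<v}" n] uv
      by (subst Bochner_Integration.integral_add) (auto simp: mult.commute emeasure_lborel_Ioo)
    finally show ?thesis .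
  qed
  show "\<exists>\<delta>>0. \<forall>(m::nat) u v. (\<forall>k<m. a \<le> u k \<and> u k \<le> v k \<and> v k \<le> b) \<and>
      disjoint_family_on (\<lambda>k. {u k<..<v k}) {..<m} \<and> (\<Sum>k<m. v k - u k) < \<delta> \<longrightarrow>
      (\<Sum>k<m. \<bar>integral\<^sup>L (lebesgue_on {a..v k}) h - integral\<^sup>L (lebesgue_on {a..u k}) h\<bar>) < e"
  proof (intro exI[of _ \<delta>] conjI allI impI \<open>\<delta> > 0\<close>; elim conjE)
    fix m :: nat and u v :: "nat \<Rightarrow> real"
    assume H: "\<forall>k<m. a \<le> u k \<and> u k \<le> v k \<and> v k \<le> b"
      "disjoint_family_on (\<lambda>k. {u k<..<v k}) {..<m}" "(\<Sum>k<m. v k - u k) < \<delta>"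
    have int: "integrable lebesgue (\<lambda>x. indicator {u k<..<v k} x * r n x)" for k
      using integrable_real_mult_indicator[OF _ r, of "{u k<..<v k}" n] by (simp add: mult.commute)
    have "(\<Sum>k<m. \<bar>integral\<^sup>L (lebesgue_on {a..v k}) h - integral\<^sup>L (lebesgue_on {a..u k}) h\<bar>) \<le>
      (\<Sum>k<m. integral\<^sup>L lebesgue (\<lambda>x. indicator {u k<..<v k} x * r n x) + real n * (v k - u k))"
      using H by (intro sum_mono one) auto
    also have "\<dots> = integral\<^sup>L lebesgue (\<lambda>x. \<Sum>k<m. indicator {u k<..<v k} x * r n x) + real n * (\<Sum>k<m. v k - u k)"
      by (subst Bochner_Integration.integral_sum) (auto simp: int sum.distrib sum_distrib_left)
    also have "\<dots> \<le> integral\<^sup>L lebesgue (r n) + real n * (\<Sum>k<m. v k - u k)"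
    proof (intro add_right_mono integral_mono r Bochner_Integration.integrable_sum int)
      fix x
      \<comment> \<open>Disjointness turns the sum of indicators into the indicator of a union.
        Hence all the remainders together cost a single integral of \<open>r n\<close>, however many
        intervals there are.\<close>
      have "(\<Sum>k<m. indicator {u k<..<v k} x * r n x) = indicator (\<Union>k<m. {u k<..<v k}) x * r n x"
        using H(2) by (simp add: sum_distrib_right[symmetric] indicator_UN_disjoint)
      also have "\<dots> \<le> r n x" using r0[of x] by (auto simp: indicator_def)
      finally show "(\<Sum>k<m. indicator {u k<..<v k} x * r n x) \<le> r n x" .
    qed
    also have "\<dots> < e / 2 + e / 2"
    proof (rule add_less_le_mono[OF n])
      have "real n * (\<Sum>k<m. v k - u k) \<le> (real n + 1) * \<delta>"
        using H(1,3) \<open>\<delta> > 0\<close> by (intro mult_mono) (auto intro: sum_nonneg)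
      also have "\<dots> = e / 2"
      proof -
        have "c * (e / (2 * c)) = e / 2" if "c > 0" for c using that by simp
        from this[of "real n + 1"] show ?thesis by (simp add: \<delta>_def)
      qed
      finally show "real n * (\<Sum>k<m. v k - u k) \<le> e / 2" .
    qed
    finally show "(\<Sum>k<m. \<bar>integral\<^sup>L (lebesgue_on {a..v k}) h - integral\<^sup>L (lebesgue_on {a..u k}) h\<bar>) < e"
      by simp
  qed
qed

text \<open>Lebesgue differentiation for averages over cubes with the point as lower corner. In
  dimension one such a cube is {x..x + h}, so only the right difference quotient is
  obtained.\<close>

lemma primitive_right_difference_quotient:
  fixes f :: "real \<Rightarrow> real"
  assumes "integrable lebesgue f"
  obtains N where "negligible N" "\<And>x. x \<notin> N \<Longrightarrow> ((\<lambda>s. integral {x..x + s} f / s) \<longlongrightarrow> f x) (at_right 0)"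
proof -
  have "f absolutely_integrable_on cbox u v" for u v
    using assms integrable_mult_indicator[of "cbox u v" lebesgue f] by (simp add: set_integrable_def)
  then have "f integrable_on cbox u v" for u v
    by (simp add: set_lebesgue_integral_eq_integral(1))
  then obtain N where N: "negligible N" "\<And>x e. \<lbrakk>x \<notin> N; 0 < e\<rbrakk> \<Longrightarrow>
      \<exists>d>0. \<forall>h. 0 < h \<and> h < d \<longrightarrow> norm(integral (cbox x (x + h *\<^sub>R One)) f /\<^sub>R h ^ DIM(real) - f x) < e"
    using integrable_ccontinuous_explicit by blast
  show thesis
  proof (rule that[OF N(1)])
    fix x assume "x \<notin> N"
    show "((\<lambda>s. integral {x..x + s} f / s) \<longlongrightarrow> f x) (at_right 0)"
    proof (rule tendstoI)
      fix e :: real assume "e > 0"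
      obtain d where "d > 0" "\<forall>h. 0 < h \<and> h < d \<longrightarrow>
          norm(integral (cbox x (x + h *\<^sub>R One)) f /\<^sub>R h ^ DIM(real) - f x) < e"
        using N(2)[OF \<open>x \<notin> N\<close> \<open>e > 0\<close>] by blast
      then show "\<forall>\<^sub>F s in at_right 0. dist (integral {x..x + s} f / s) (f x) < e"
        unfolding eventually_at_right_field
        by (intro exI[of _ d]) (auto simp: dist_real_def divide_inverse mult.commute)
    qed
  qed
qed

text \<open>The left difference quotient at x is the right one of the reflected function at -x. The
  exceptional set of the reflected function is mapped back by \<open>uminus\<close>, a
  differentiable map, and so stays negligible. Extending the integrand by 0 makes the
  differentiation theorem on the line applicable.\<close>

lemma AE_primitive_has_derivative:
  fixes h :: "real \<Rightarrow> real"
  assumes h: "integrable (lebesgue_on {a..b}) h"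
  shows "AE x in lebesgue_on {a..b}.
    ((\<lambda>t. integral\<^sup>L (lebesgue_on {a..t}) h) has_real_derivative h x) (at x within {a..b})"
proof -
  let ?F = "\<lambda>t. integral\<^sup>L (lebesgue_on {a..t}) h"
  define f where "f x = indicator {a..b} x * h x" for x
  have f: "integrable lebesgue f"
    using h by (simp add: integrable_restrict_space f_def[abs_def])
  have f': "integrable lebesgue (\<lambda>x. f (- x))"
    using lebesgue_integrable_real_affine[OF f, of "-1" 0] by simp
  obtain N where N: "negligible N"
    "\<And>x. x \<notin> N \<Longrightarrow> ((\<lambda>s. integral {x..x + s} f / s) \<longlongrightarrow> f x) (at_right 0)"
    using primitive_right_difference_quotient[OF f] by blast
  obtain N' where N': "negligible N'"
    "\<And>x. x \<notin> N' \<Longrightarrow> ((\<lambda>s. integral {x..x + s} (\<lambda>x. f (- x)) / s) \<longlongrightarrow> f (- x)) (at_right 0)"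
    using primitive_right_difference_quotient[OF f'] by blast
  have "negligible (uminus ` N')"
    using N'(1) by (intro negligible_differentiable_image_negligible) (auto simp: differentiable_on_minus)
  then have null: "N \<union> uminus ` N' \<in> null_sets lebesgue"
    using N(1) by (metis negligible_Un negligible_iff_null_sets)
  have FD: "?F v - ?F u = integral {u..v} f" if "a \<le> u" "u \<le> v" "v \<le> b" for u v
    unfolding primitive_diff[OF h that]
    by (rule Henstock_Kurzweil_Integration.integral_cong) (use that in \<open>auto simp: f_def\<close>)
  have "(?F has_real_derivative h x) (at x within {a..b})"
    if x: "x \<in> {a..b}" "x \<notin> N \<union> uminus ` N'" for x
  proof -
    have fx: "f x = h x" using x by (simp add: f_def)
    have R: "((\<lambda>s. integral {x..x + s} f / s) \<longlongrightarrow> h x) (at_right 0)"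
      using N(2)[of x] x fx by simp
    have "- x \<notin> N'" using x by force
    from N'(2)[OF this] have L: "((\<lambda>s. integral {x - s..x} f / s) \<longlongrightarrow> h x) (at_right 0)"
      using Henstock_Kurzweil_Integration.integral_reflect_real[of x "x - _" f] fx by simp
    show ?thesis
      unfolding has_field_derivative_iff
    proof (rule tendstoI)
      fix e :: real assume "e > 0"
      obtain d where d: "d > 0" "\<And>s. 0 < s \<Longrightarrow> s < d \<Longrightarrow> dist (integral {x..x + s} f / s) (h x) < e"
        using tendstoD[OF R \<open>e > 0\<close>] by (auto simp: eventually_at_right_field)
      obtain d' where d': "d' > 0" "\<And>s. 0 < s \<Longrightarrow> s < d' \<Longrightarrow> dist (integral {x - s..x} f / s) (h x) < e"
        using tendstoD[OF L \<open>e > 0\<close>] by (auto simp: eventually_at_right_field)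
      show "\<forall>\<^sub>F y in at x within {a..b}. dist ((?F y - ?F x) / (y - x)) (h x) < e"
        unfolding eventually_at
      proof (intro exI[of _ "min d d'"] conjI ballI impI)
        fix y assume y: "y \<in> {a..b}" "y \<noteq> x \<and> dist y x < min d d'"
        show "dist ((?F y - ?F x) / (y - x)) (h x) < e"
        proof (cases "x < y")
          case True
          then show ?thesis
            using d(2)[of "y - x"] FD[of x y] x y by (simp add: dist_real_def)
        next
          case False
          have "(?F y - ?F x) / (y - x) = (?F x - ?F y) / (x - y)"
            by (metis minus_diff_eq minus_divide_divide)
          then show ?thesis
            using d'(2)[of "x - y"] FD[of y x] x y False by (simp add: dist_real_def)
        qed
      qed (use d d' in auto)
    qed
  qed
  then show ?thesis
    by (subst AE_restrict_space_iff) (auto intro!: AE_I'[OF null])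
qed

section \<open>The matrix exponential\<close>

lemma mult_mat_entry:
  assumes "A \<in> carrier_mat n m" "B \<in> carrier_mat m p" "i < n" "j < p"
  shows "(A * B) $$ (i, j) = (\<Sum>k<m. A $$ (i, k) * B $$ (k, j))"
  using assms by (auto simp: scalar_prod_def atLeast0LessThan)

lemma mult_mat_vec_entry:
  assumes "A \<in> carrier_mat n m" "v \<in> carrier_vec m" "i < n"
  shows "(A *\<^sub>v v) $ i = (\<Sum>k<m. A $$ (i, k) * v $ k)"
  using assms by (auto simp: scalar_prod_def atLeast0LessThan)

lemma pow_mat_smult:
  fixes A :: "'a :: comm_ring_1 mat"
  assumes "A \<in> carrier_mat n n"
  shows "(c \<cdot>\<^sub>m A) ^\<^sub>m m = c ^ m \<cdot>\<^sub>m (A ^\<^sub>m m)"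
proof (induction m)
  case (Suc m)
  have "(c ^ m \<cdot>\<^sub>m A ^\<^sub>m m) * (c \<cdot>\<^sub>m A) = c \<cdot>\<^sub>m (c ^ m \<cdot>\<^sub>m (A ^\<^sub>m m * A))"
    using assms by (simp add: mult_smult_distrib[of _ n n _ n] mult_smult_assoc_mat[of _ n n _ n])
  also have "\<dots> = c ^ Suc m \<cdot>\<^sub>m (A ^\<^sub>m Suc m)"
    using assms by (intro eq_matI) auto
  finally show ?case using Suc by simp
qed (use assms in \<open>auto intro!: eq_matI\<close>)

text \<open>B is the sum of the absolute values of all entries. It dominates every column sum, so
  each further factor A costs at most one factor B; the geometric growth makes the exponential
  series a convergent majorant.\<close>

lemma pow_mat_entry_bound:
  fixes A :: "real mat"
  assumes A: "A \<in> carrier_mat n n"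
  obtains B where "0 \<le> B" "\<And>m j k. j < n \<Longrightarrow> k < n \<Longrightarrow> \<bar>(A ^\<^sub>m m) $$ (j, k)\<bar> \<le> B ^ m"
proof
  define B where "B = (\<Sum>l<n. \<Sum>k<n. \<bar>A $$ (l, k)\<bar>)"
  show "0 \<le> B" by (auto simp: B_def intro!: sum_nonneg)
  show "\<bar>(A ^\<^sub>m m) $$ (j, k)\<bar> \<le> B ^ m" if "j < n" "k < n" for m j k
    using that
  proof (induction m arbitrary: k)
    case (Suc m)
    have "\<bar>(A ^\<^sub>m Suc m) $$ (j, k)\<bar> = \<bar>\<Sum>l<n. (A ^\<^sub>m m) $$ (j, l) * A $$ (l, k)\<bar>"
      using A Suc.prems by (simp add: mult_mat_entry[of _ n n _ n] del: index_mult_mat)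
    also have "\<dots> \<le> (\<Sum>l<n. \<bar>(A ^\<^sub>m m) $$ (j, l)\<bar> * \<bar>A $$ (l, k)\<bar>)"
      by (rule order.trans[OF sum_abs]) (simp add: abs_mult)
    also have "\<dots> \<le> (\<Sum>l<n. B ^ m * \<bar>A $$ (l, k)\<bar>)"
      using Suc by (intro sum_mono mult_right_mono) auto
    also have "\<dots> = B ^ m * (\<Sum>l<n. \<bar>A $$ (l, k)\<bar>)" by (simp add: sum_distrib_left)
    also have "\<dots> \<le> B ^ m * B"
    proof (rule mult_left_mono)
      show "(\<Sum>l<n. \<bar>A $$ (l, k)\<bar>) \<le> B"
        unfolding B_def using Suc.prems by (intro sum_mono member_le_sum) auto
    qed (use \<open>0 \<le> B\<close> in auto)
    finally show ?case by (simp add: mult.commute)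
  qed (use A in auto)
qed

text \<open>The recursion of \<open>pow_mat\<close> multiplies on the right; the derivative in the
  form A exp(tA) requires the factor on the left.\<close>

lemma pow_mat_Suc_left:
  fixes A :: "'a :: semiring_1 mat"
  assumes "A \<in> carrier_mat n n"
  shows "A ^\<^sub>m Suc m = A * A ^\<^sub>m m"
  using assms
proof (induction m)
  case (Suc m)
  have "A ^\<^sub>m Suc (Suc m) = (A * A ^\<^sub>m m) * A"
    using Suc by simp
  also have "\<dots> = A * (A ^\<^sub>m m * A)"
    using Suc.prems by (intro assoc_mult_mat[of _ n n _ n _ n]) auto
  finally show ?case by simp
qed auto

lemma mat_exp_carrier [simp]: "A \<in> carrier_mat n n \<Longrightarrow> mat_exp (t \<cdot>\<^sub>m A) \<in> carrier_mat n n"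
  by (auto simp: mat_exp_def)

text \<open>Each entry becomes a scalar power series in t, so that termwise differentiation of power
  series is applicable.\<close>

lemma mat_exp_entry:
  assumes A: "A \<in> carrier_mat n n" and "j < n" "k < n"
  shows "summable (\<lambda>m. (A ^\<^sub>m m) $$ (j, k) / fact m * t ^ m)"
    and "mat_exp (t \<cdot>\<^sub>m A) $$ (j, k) = (\<Sum>m. (A ^\<^sub>m m) $$ (j, k) / fact m * t ^ m)"
proof -
  obtain B where B: "0 \<le> B" "\<And>m. \<bar>(A ^\<^sub>m m) $$ (j, k)\<bar> \<le> B ^ m"
    using pow_mat_entry_bound[OF A] assms by metis
  show "summable (\<lambda>m. (A ^\<^sub>m m) $$ (j, k) / fact m * t ^ m)"
  proof (rule summable_comparison_test'[of "\<lambda>m. inverse (fact m) * (B * \<bar>t\<bar>) ^ m" 0])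
    show "summable (\<lambda>m. inverse (fact m) * (B * \<bar>t\<bar>) ^ m)"
      by (rule summable_exp)
    show "norm ((A ^\<^sub>m m) $$ (j, k) / fact m * t ^ m) \<le> inverse (fact m) * (B * \<bar>t\<bar>) ^ m" for m
      using mult_right_mono[OF B(2)[of m], of "\<bar>t\<bar> ^ m / fact m"]
      by (simp add: abs_mult power_abs power_mult_distrib divide_inverse mult_ac)
  qed
  show "mat_exp (t \<cdot>\<^sub>m A) $$ (j, k) = (\<Sum>m. (A ^\<^sub>m m) $$ (j, k) / fact m * t ^ m)"
    using assms by (simp add: mat_exp_def pow_mat_smult[OF A] mult.commute)
qed

lemma mat_exp_entry_sums:
  assumes "A \<in> carrier_mat n n" "j < n" "k < n"
  shows "(\<lambda>m. (A ^\<^sub>m m) $$ (j, k) / fact m * t ^ m) sums mat_exp (t \<cdot>\<^sub>m A) $$ (j, k)"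
  unfolding mat_exp_entry(2)[OF assms] using mat_exp_entry(1)[OF assms] by (rule summable_sums)

lemma mat_exp_0:
  assumes A: "A \<in> carrier_mat n n"
  shows "mat_exp (0 \<cdot>\<^sub>m A) = 1\<^sub>m n"
proof (rule eq_matI)
  fix j k assume "j < dim_row (1\<^sub>m n :: real mat)" "k < dim_col (1\<^sub>m n :: real mat)"
  then show "mat_exp (0 \<cdot>\<^sub>m A) $$ (j, k) = 1\<^sub>m n $$ (j, k)"
    using A powser_zero[of "\<lambda>m. (A ^\<^sub>m m) $$ (j, k) / fact m"]
    by (simp add: mat_exp_entry(2)[OF A])
qed (use A in \<open>auto simp: mat_exp_def\<close>)

text \<open>Both forms are used: the factor on the left produces the differential equation, the one
  on the right lets A cancel between two adjacent exponentials in \<open>mat_exp_mult\<close> and in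
  the uniqueness proof.\<close>

lemma mat_exp_has_derivative:
  assumes A: "A \<in> carrier_mat n n" and jk: "j < n" "k < n"
  shows "((\<lambda>t. mat_exp (t \<cdot>\<^sub>m A) $$ (j, k)) has_real_derivative
      (\<Sum>l<n. A $$ (j, l) * mat_exp (t \<cdot>\<^sub>m A) $$ (l, k))) (at t)" (is ?left)
    and "((\<lambda>t. mat_exp (t \<cdot>\<^sub>m A) $$ (j, k)) has_real_derivative
      (\<Sum>l<n. mat_exp (t \<cdot>\<^sub>m A) $$ (j, l) * A $$ (l, k))) (at t)" (is ?right)
proof -
  define c where "c m = (A ^\<^sub>m m) $$ (j, k) / fact m" for m
  have D: "((\<lambda>t. mat_exp (t \<cdot>\<^sub>m A) $$ (j, k)) has_real_derivative (\<Sum>m. diffs c m * t ^ m)) (at t)"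
    unfolding mat_exp_entry(2)[OF A jk] c_def[symmetric]
    by (rule termdiffs_strong_converges_everywhere)
      (use mat_exp_entry(1)[OF A jk] in \<open>simp add: c_def\<close>)
  have diffs: "diffs c m = (A ^\<^sub>m Suc m) $$ (j, k) / fact m" for m
    by (simp add: diffs_def c_def del: pow_mat.simps)
  have "diffs c m * t ^ m = (\<Sum>l<n. A $$ (j, l) * ((A ^\<^sub>m m) $$ (l, k) / fact m * t ^ m))" for m
    unfolding diffs pow_mat_Suc_left[OF A] using A jk
    by (simp add: mult_mat_entry[of _ n n _ n] sum_divide_distrib sum_distrib_right mult.assoc del: index_mult_mat)
  then have "(\<Sum>m. diffs c m * t ^ m) = (\<Sum>m. \<Sum>l<n. A $$ (j, l) * ((A ^\<^sub>m m) $$ (l, k) / fact m * t ^ m))"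
    by simp
  also have "\<dots> = (\<Sum>l<n. A $$ (j, l) * mat_exp (t \<cdot>\<^sub>m A) $$ (l, k))"
    using jk by (intro sums_unique[symmetric] sums_sum sums_mult mat_exp_entry_sums[OF A]) auto
  finally show ?left using D by simp
  have "diffs c m * t ^ m = (\<Sum>l<n. ((A ^\<^sub>m m) $$ (j, l) / fact m * t ^ m) * A $$ (l, k))" for m
    unfolding diffs using A jk
    by (simp add: mult_mat_entry[of _ n n _ n] sum_divide_distrib sum_distrib_right sum_distrib_left mult_ac del: index_mult_mat)
  then have "(\<Sum>m. diffs c m * t ^ m) = (\<Sum>m. \<Sum>l<n. ((A ^\<^sub>m m) $$ (j, l) / fact m * t ^ m) * A $$ (l, k))"
    by simp
  also have "\<dots> = (\<Sum>l<n. mat_exp (t \<cdot>\<^sub>m A) $$ (j, l) * A $$ (l, k))"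
    using jk by (intro sums_unique[symmetric] sums_sum sums_mult2 mat_exp_entry_sums[OF A]) auto
  finally show ?right using D by simp
qed

lemma continuous_on_mat_exp_entry:
  assumes "A \<in> carrier_mat n n" "j < n" "k < n"
  shows "continuous_on S (\<lambda>t. mat_exp (t \<cdot>\<^sub>m A) $$ (j, k))"
  by (rule DERIV_continuous_on[OF DERIV_subset[OF mat_exp_has_derivative(1)[OF assms]]]) auto

text \<open>The product \<open>exp (v A) exp ((u + s - v) A)\<close> has zero derivative in \<open>v\<close>.\<close>

lemma mat_exp_mult:
  assumes A: "A \<in> carrier_mat n n"
  shows "mat_exp (u \<cdot>\<^sub>m A) * mat_exp (s \<cdot>\<^sub>m A) = mat_exp ((u + s) \<cdot>\<^sub>m A)"
proof (rule eq_matI)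
  define e where "e t j k = mat_exp (t \<cdot>\<^sub>m A) $$ (j, k)" for t j k
  fix j k assume "j < dim_row (mat_exp ((u + s) \<cdot>\<^sub>m A))" "k < dim_col (mat_exp ((u + s) \<cdot>\<^sub>m A))"
  then have jk: "j < n" "k < n" using A by (auto simp: mat_exp_def)
  define G where "G v = (\<Sum>l<n. e v j l * e (u + s - v) l k)" for v
  have D: "DERIV G v :> 0" for v
  proof -
    have "DERIV (\<lambda>v. e v j l) v :> (\<Sum>p<n. e v j p * A $$ (p, l))" if "l < n" for l
      using mat_exp_has_derivative(2)[OF A jk(1) that] by (simp add: e_def)
    moreover have "DERIV (\<lambda>v. e (u + s - v) l k) v :> (\<Sum>p<n. A $$ (l, p) * e (u + s - v) p k) * (- 1)"
      if "l < n" for l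
      unfolding e_def
      by (rule DERIV_chain2[OF mat_exp_has_derivative(1)[OF A that jk(2)]])
        (auto intro!: derivative_eq_intros)
    ultimately have "DERIV G v :> (\<Sum>l<n. (\<Sum>p<n. e v j p * A $$ (p, l)) * e (u + s - v) l k +
        ((\<Sum>p<n. A $$ (l, p) * e (u + s - v) p k) * (- 1)) * e v j l)"
      unfolding G_def by (intro DERIV_sum DERIV_mult) auto
    \<comment> \<open>After the swap both terms are the (j,k) entry of exp(vA) A exp((u + s - v)A);
      the chain rule gives one of them a minus sign.\<close>
    moreover have "(\<Sum>l<n. (\<Sum>p<n. e v j p * A $$ (p, l)) * e (u + s - v) l k) =
        (\<Sum>l<n. \<Sum>p<n. A $$ (l, p) * e (u + s - v) p k * e v j l)"
      unfolding sum_distrib_right by (subst sum.swap) (simp add: mult_ac)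
    ultimately show ?thesis
      by (simp add: sum.distrib sum_negf sum_subtractf sum_distrib_right)
  qed
  have "G u = G 0"
    using DERIV_isconst_all[of G u 0] D by auto
  also have "G 0 = (1\<^sub>m n * mat_exp ((u + s) \<cdot>\<^sub>m A)) $$ (j, k)"
    unfolding G_def e_def mat_exp_0[OF A]
    by (subst mult_mat_entry[of _ n n _ n]) (use A jk in auto)
  finally show "(mat_exp (u \<cdot>\<^sub>m A) * mat_exp (s \<cdot>\<^sub>m A)) $$ (j, k) = mat_exp ((u + s) \<cdot>\<^sub>m A) $$ (j, k)"
    unfolding G_def e_def using A jk
    by (subst mult_mat_entry[of _ n n _ n]) (auto simp: left_mult_one_mat[of _ n n])
qed (use A in \<open>auto simp: mat_exp_def\<close>)

section \<open>Norm bounds\<close>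

lemma vec_norm2_nonneg [simp]: "0 \<le> vec_norm2 v"
  by (simp add: vec_norm2_def L2_set_nonneg)

lemma vec_norm2_entry_le:
  assumes "j < dim_vec v"
  shows "norm (v $ j) \<le> vec_norm2 v"
  unfolding vec_norm2_def using assms by (intro member_le_L2_set) auto

lemma vec_norm2_le_sum: "vec_norm2 v \<le> (\<Sum>j<dim_vec v. norm (v $ j))"
  unfolding vec_norm2_def by (rule L2_set_le_sum) auto

lemma vec_norm2_smult: "vec_norm2 (c \<cdot>\<^sub>v v) = norm c * vec_norm2 v"
  by (auto simp: vec_norm2_def norm_mult L2_set_right_distrib intro!: L2_set_cong)

lemma vec_norm2_of_real: "vec_norm2 (map_vec (of_real :: real \<Rightarrow> 'a :: real_normed_field) v) = vec_norm2 v"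
  by (auto simp: vec_norm2_def intro!: L2_set_cong)

lemma vec_norm2_add_le:
  assumes "u \<in> carrier_vec n" "v \<in> carrier_vec n"
  shows "vec_norm2 (u + v) \<le> vec_norm2 u + vec_norm2 v"
proof -
  have "vec_norm2 (u + v) \<le> L2_set (\<lambda>j. norm (u $ j) + norm (v $ j)) {..<n}"
    unfolding vec_norm2_def using assms by (auto intro!: L2_set_mono norm_triangle_ineq)
  also have "\<dots> \<le> vec_norm2 u + vec_norm2 v"
    using L2_set_triangle_ineq[of "\<lambda>j. norm (u $ j)" "\<lambda>j. norm (v $ j)" "{..<n}"] assms
    by (simp add: vec_norm2_def)
  finally show ?thesis .
qed

text \<open>The Euclidean norm of the image is bounded by the sum of its m coordinates, each of
  which has n terms of size at most K times the norm of v. The loss is harmless because all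
  dimensions are at most D; this is the origin of D^2.\<close>

lemma vec_norm2_mult_le_entries:
  assumes M: "M \<in> carrier_mat m n" and v: "v \<in> carrier_vec n"
    and K: "\<And>i j. i < m \<Longrightarrow> j < n \<Longrightarrow> norm (M $$ (i, j)) \<le> K"
  shows "vec_norm2 (M *\<^sub>v v) \<le> real m * real n * K * vec_norm2 v"
proof -
  have "vec_norm2 (M *\<^sub>v v) \<le> (\<Sum>i<m. norm (\<Sum>j<n. M $$ (i, j) * v $ j))"
    using vec_norm2_le_sum[of "M *\<^sub>v v"] M v by (simp add: mult_mat_vec_entry[OF M v] del: index_mult_mat_vec)
  also have "\<dots> \<le> (\<Sum>i<m. \<Sum>j<n. K * vec_norm2 v)"
  proof (rule sum_mono)
    fix i assume i: "i \<in> {..<m}"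
    have "norm (\<Sum>j<n. M $$ (i, j) * v $ j) \<le> (\<Sum>j<n. norm (M $$ (i, j)) * norm (v $ j))"
      by (rule order.trans[OF norm_sum]) (simp add: norm_mult)
    also have "\<dots> \<le> (\<Sum>j<n. K * vec_norm2 v)"
    proof (intro sum_mono mult_mono)
      fix j assume j: "j \<in> {..<n}"
      show "norm (M $$ (i, j)) \<le> K" using K i j by auto
      show "0 \<le> K" using norm_ge_zero order.trans K i j by (metis lessThan_iff)
      show "norm (v $ j) \<le> vec_norm2 v" using v j by (intro vec_norm2_entry_le) auto
    qed auto
    finally show "norm (\<Sum>j<n. M $$ (i, j) * v $ j) \<le> (\<Sum>j<n. K * vec_norm2 v)" .
  qed
  also have "\<dots> = real m * real n * K * vec_norm2 v" by simp
  finally show ?thesis .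
qed

text \<open>Makes the set in the supremum \<open>mat_opnorm\<close> bounded above, and settles
  vectors of norm 0, which cannot be normalized.\<close>

lemma vec_norm2_mult_le_sum_entries:
  assumes M: "M \<in> carrier_mat m n" and v: "v \<in> carrier_vec n"
  shows "vec_norm2 (M *\<^sub>v v) \<le> real m * real n * (\<Sum>i<m. \<Sum>j<n. norm (M $$ (i, j))) * vec_norm2 v"
proof (rule vec_norm2_mult_le_entries[OF M v])
  fix i j assume "i < m" "j < n"
  then have "norm (M $$ (i, j)) \<le> (\<Sum>j<n. norm (M $$ (i, j)))"
    by (intro member_le_sum) auto
  also have "\<dots> \<le> (\<Sum>i<m. \<Sum>j<n. norm (M $$ (i, j)))"
    using \<open>i < m\<close> by (intro member_le_sum[of i _ "\<lambda>i. \<Sum>j<n. norm (M $$ (i, j))"]) (auto intro: sum_nonneg)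
  finally show "norm (M $$ (i, j)) \<le> (\<Sum>i<m. \<Sum>j<n. norm (M $$ (i, j)))" .
qed

lemma mat_opnorm_upper:
  assumes M: "M \<in> carrier_mat m n" and v: "v \<in> carrier_vec n" "vec_norm2 v \<le> 1"
  shows "vec_norm2 (M *\<^sub>v v) \<le> mat_opnorm M"
  unfolding mat_opnorm_def
proof (rule cSUP_upper)
  show "v \<in> {v \<in> carrier_vec (dim_col M). vec_norm2 v \<le> 1}" using M v by auto
  let ?S = "\<Sum>i<m. \<Sum>j<n. norm (M $$ (i, j))"
  have "vec_norm2 (M *\<^sub>v u) \<le> real m * real n * ?S" if "u \<in> carrier_vec n" "vec_norm2 u \<le> 1" for u
  proof -
    have "real m * real n * ?S * vec_norm2 u \<le> real m * real n * ?S * 1"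
      using that by (intro mult_left_mono mult_nonneg_nonneg sum_nonneg) auto
    then show ?thesis using vec_norm2_mult_le_sum_entries[OF M that(1)] by simp
  qed
  then show "bdd_above ((\<lambda>v. vec_norm2 (M *\<^sub>v v)) ` {v \<in> carrier_vec (dim_col M). vec_norm2 v \<le> 1})"
    using M by (intro bdd_aboveI[of _ "real m * real n * ?S"]) auto
qed

lemma mat_opnorm_nonneg: "0 \<le> mat_opnorm M"
proof (rule order.trans[OF vec_norm2_nonneg])
  show "vec_norm2 (M *\<^sub>v 0\<^sub>v (dim_col M)) \<le> mat_opnorm M"
    by (rule mat_opnorm_upper[of _ "dim_row M" "dim_col M"]) (auto simp: vec_norm2_def L2_set_def)
qed

lemma vec_norm2_mult_le_opnorm:
  assumes M: "M \<in> carrier_mat m n" and v: "v \<in> carrier_vec n"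
  shows "vec_norm2 (M *\<^sub>v v) \<le> mat_opnorm M * vec_norm2 v"
proof (cases "vec_norm2 v = 0")
  case True
  then show ?thesis using vec_norm2_mult_le_sum_entries[OF M v] by simp
next
  case False
  then have pos: "vec_norm2 v > 0" using vec_norm2_nonneg[of v] by linarith
  define c :: 'a where "c = of_real (1 / vec_norm2 v)"
  have c: "norm c = 1 / vec_norm2 v" using pos by (simp add: c_def del: of_real_divide)
  have "M *\<^sub>v (c \<cdot>\<^sub>v v) = c \<cdot>\<^sub>v (M *\<^sub>v v)"
    using M v by (rule mult_mat_vec)
  moreover have "vec_norm2 (M *\<^sub>v (c \<cdot>\<^sub>v v)) \<le> mat_opnorm M"
    by (rule mat_opnorm_upper[OF M]) (use v pos c in \<open>auto simp: vec_norm2_smult\<close>)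
  ultimately have "vec_norm2 (M *\<^sub>v v) / vec_norm2 v \<le> mat_opnorm M"
    by (simp add: vec_norm2_smult c)
  then show ?thesis using pos by (simp add: divide_le_eq)
qed

text \<open>One term of a series of nonnegative terms. It absorbs the polynomial factor of a Jordan
  block, with a bound independent of the block size.\<close>

lemma exp_ge_term:
  fixes t :: real
  assumes "0 \<le> t"
  shows "t ^ p / fact p \<le> exp t"
proof -
  have S: "(\<lambda>n. t ^ n / fact n) sums exp t"
    using exp_converges[of t] by (simp add: divide_inverse mult.commute)
  show ?thesis
    using sum_le_suminf[OF sums_summable[OF S], of "{p}"] assms sums_unique[OF S] by simp
qed

text \<open>On a Jordan block, the exponential series sums to \<open>t ^ p / p! * exp (t a)\<close> on the
  \<open>p\<close>-th superdiagonal.\<close>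

lemma jordan_block_exp_sums:
  fixes a :: complex
  assumes ij: "i < n" "j < n" and a: "Re a \<le> 0" and t: "0 \<le> t"
  shows "\<exists>e. (\<lambda>m. (jordan_block n a ^\<^sub>m m) $$ (i, j) / fact m * of_real t ^ m) sums e \<and> norm e \<le> exp t"
proof (cases "i \<le> j")
  case False
  then have "(\<lambda>m. (jordan_block n a ^\<^sub>m m) $$ (i, j) / fact m * of_real t ^ m) = (\<lambda>_. 0)"
    using ij by (auto simp: jordan_block_pow)
  then show ?thesis by (auto intro!: exI[of _ 0])
next
  case True
  define p where "p = j - i"
  define f where "f m = of_nat (m choose p) * a ^ (m - p) / fact m * of_real t ^ m" for m
  \<comment> \<open>Both sides are truncated subtractions. For m < p the exponent is 0, but the
    binomial coefficient vanishes, so these terms contribute nothing.\<close>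
  have "m + i - j = m - p" for m using True by (auto simp: p_def)
  then have feq: "(\<lambda>m. (jordan_block n a ^\<^sub>m m) $$ (i, j) / fact m * of_real t ^ m) = f"
    using ij True by (auto simp: jordan_block_pow f_def p_def)
  \<comment> \<open>Since (m + p choose p) / (m + p)! = 1 / (p! m!), the series shifted by p is an
    exponential series with a constant factor.\<close>
  have "f (m + p) = of_real (t ^ p / fact p) * ((of_real t * a) ^ m /\<^sub>R fact m)" for m
  proof -
    have "of_nat (m + p choose p) = (fact (m + p) / (fact p * fact m) :: complex)"
      using binomial_fact[of p "m + p"] by simp
    then show ?thesis
      by (simp add: f_def power_add power_mult_distrib scaleR_conv_of_real divide_inverse mult_ac)
  qed
  then have "(\<lambda>m. f (m + p)) sums (of_real (t ^ p / fact p) * exp (of_real t * a))"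
    by (simp only:) (intro sums_mult exp_converges)
  then have "f sums (of_real (t ^ p / fact p) * exp (of_real t * a) + (\<Sum>m<p. f m))"
    by (simp add: sums_iff_shift)
  moreover have "(\<Sum>m<p. f m) = 0" by (intro sum.neutral) (auto simp: f_def binomial_eq_0)
  ultimately have "f sums (of_real (t ^ p / fact p) * exp (of_real t * a))" by simp
  moreover have "norm (of_real (t ^ p / fact p) * exp (of_real t * a) :: complex) \<le> exp t"
  proof -
    have "norm (exp (of_real t * a)) \<le> 1" using a t by (simp add: mult_nonneg_nonpos)
    then have "(t ^ p / fact p) * norm (exp (of_real t * a)) \<le> (t ^ p / fact p) * 1"
      using t by (intro mult_left_mono) auto
    also have "\<dots> \<le> exp t" using exp_ge_term[OF t] by simp
    finally show ?thesis using t by (simp add: norm_mult norm_power norm_divide)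
  qed
  ultimately show ?thesis unfolding feq by blast
qed

text \<open>Powers of a block diagonal matrix are block diagonal, so an entry sees at most one block
  and the bound does not grow with the number of blocks. The sign condition concerns nonempty blocks
  because only these contribute an eigenvalue.\<close>

lemma jordan_matrix_exp_sums:
  fixes js :: "(nat \<times> complex) list"
  assumes "\<And>n a. (n, a) \<in> set js \<Longrightarrow> 0 < n \<Longrightarrow> Re a \<le> 0" and t: "0 \<le> t"
    and "i < sum_list (map fst js)" "j < sum_list (map fst js)"
  shows "\<exists>e. (\<lambda>m. (jordan_matrix js ^\<^sub>m m) $$ (i, j) / fact m * of_real t ^ m) sums e \<and> norm e \<le> exp t"
  using assms(1,3,4)
proof (induction js arbitrary: i j)
  case (Cons na js)
  obtain n a where na: "na = (n, a)" by force
  let ?N = "sum_list (map fst js)"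
  have pow: "jordan_matrix (na # js) ^\<^sub>m m = four_block_mat (jordan_block n a ^\<^sub>m m) (0\<^sub>m n ?N) (0\<^sub>m ?N n)
      (jordan_matrix js ^\<^sub>m m)" for m
    unfolding jordan_matrix_pow[of "na # js"]
    by (simp add: na jordan_matrix_pow[symmetric] Let_def)
  have entry: "(jordan_matrix (na # js) ^\<^sub>m m) $$ (i, j) =
      (if i < n then if j < n then (jordan_block n a ^\<^sub>m m) $$ (i, j) else 0
       else if j < n then 0 else (jordan_matrix js ^\<^sub>m m) $$ (i - n, j - n))" for m
    unfolding pow using Cons.prems na by (subst index_mat_four_block) auto
  consider "i < n" "j < n" | "(i < n) \<noteq> (j < n)" | "n \<le> i" "n \<le> j" by linarith
  then show ?case
  proof cases
    case 1
    then show ?thesis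
      unfolding entry using jordan_block_exp_sums[of i n j a t] Cons.prems(1)[of n a] t
      by (simp add: na)
  next
    case 2
    then have "(jordan_matrix (na # js) ^\<^sub>m m) $$ (i, j) = 0" for m
      unfolding entry by auto
    then show ?thesis by (auto intro!: exI[of _ 0])
  next
    case 3
    then have "i - n < ?N" "j - n < ?N" using Cons.prems na by auto
    moreover have "Re c \<le> 0" if "(k, c) \<in> set js" "0 < k" for k c
      using that by (intro Cons.prems(1)[of k]) auto
    ultimately have "\<exists>e. (\<lambda>m. (jordan_matrix js ^\<^sub>m m) $$ (i - n, j - n) / fact m * of_real t ^ m) sums e
        \<and> norm e \<le> exp t"
      by (intro Cons.IH)
    then show ?thesis
      unfolding entry using 3 by simp
  qed
qed auto

text \<open>The Jordan form is complex, so the estimate is made after embedding into the complex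
  numbers: A = Q J P gives exp(tA) = Q exp(tJ) P. The operator norms of P and Q enter only through
  their product.\<close>

lemma mat_exp_norm_bound:
  assumes A: "A \<in> carrier_mat n n" and v: "v \<in> carrier_vec n" and t: "0 \<le> t"
    and wit: "similar_mat_wit (jordan_matrix js) (cmat A) P Q"
    and ev: "\<And>\<mu>. eigenvalue (cmat A) \<mu> \<Longrightarrow> Re \<mu> \<le> 0"
  shows "vec_norm2 (mat_exp (t \<cdot>\<^sub>m A) *\<^sub>v v)
      \<le> mat_opnorm P * mat_opnorm Q * (real n)\<^sup>2 * exp t * vec_norm2 v"
proof -
  let ?J = "jordan_matrix js"
  have wit': "similar_mat_wit (cmat A) ?J Q P" using wit by (rule similar_mat_wit_sym)
  have cA: "cmat A \<in> carrier_mat n n" using A by simp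
  note D = similar_mat_witD2[OF cA wit']
  have dim: "sum_list (map fst js) = n" using D(5) by (metis carrier_matD(1) jordan_matrix_dim(1))
  \<comment> \<open>Similarity preserves the characteristic polynomial, and a nonempty block
    contributes its linear factor to that of J; so the diagonal numbers are eigenvalues of
    A.\<close>
  have Re: "Re a \<le> 0" if "(k, a) \<in> set js" "0 < k" for k a
  proof -
    have "char_poly (cmat A) = char_poly ?J"
      using wit' by (intro char_poly_similar) (auto simp: similar_mat_def)
    moreover have "[:- a, 1:] dvd char_poly ?J"
      unfolding jordan_matrix_char_poly
    proof (rule dvd_trans)
      show "[:- a, 1:] dvd [:- a, 1:] ^ k" using that by (intro dvd_power) auto
      show "[:- a, 1:] ^ k dvd (\<Prod>(n, a)\<leftarrow>js. [:- a, 1:] ^ n)"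
        using that by (intro prod_list_dvd) (force simp: image_iff)
    qed
    ultimately have "eigenvalue (cmat A) a"
      by (simp add: eigenvalue_root_char_poly[OF cA] poly_eq_0_iff_dvd)
    then show ?thesis by (rule ev)
  qed
  \<comment> \<open>This is exp(tJ), written out entrywise because \<open>mat_exp\<close> is
    restricted to real matrices.\<close>
  define E where "E = mat n n (\<lambda>(i, j). \<Sum>m. (?J ^\<^sub>m m) $$ (i, j) / fact m * of_real t ^ m)"
  have E: "E \<in> carrier_mat n n" by (simp add: E_def)
  have Esums: "(\<lambda>m. (?J ^\<^sub>m m) $$ (i, j) / fact m * of_real t ^ m) sums E $$ (i, j)"
    and Ele: "norm (E $$ (i, j)) \<le> exp t" if "i < n" "j < n" for i j
    using jordan_matrix_exp_sums[of js t i j] Re t that dim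
    by (auto simp: E_def sums_iff)
  have eq: "cmat (mat_exp (t \<cdot>\<^sub>m A)) = Q * (E * P)"
  proof (rule eq_matI)
    fix j k assume "j < dim_row (Q * (E * P))" "k < dim_col (Q * (E * P))"
    then have jk: "j < n" "k < n" using D(6,7) by auto
    have "complex_of_real ((A ^\<^sub>m m) $$ (j, k)) =
        (\<Sum>a<n. Q $$ (j, a) * (\<Sum>b<n. (?J ^\<^sub>m m) $$ (a, b) * P $$ (b, k)))" for m
    proof -
      have "complex_of_real ((A ^\<^sub>m m) $$ (j, k)) = (cmat A ^\<^sub>m m) $$ (j, k)"
        using A jk by (simp add: of_real_hom.mat_hom_pow[OF A, symmetric])
      also have "cmat A ^\<^sub>m m = Q * ?J ^\<^sub>m m * P"
        using wit' by (rule similar_mat_wit_pow_id)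
      also have "\<dots> = Q * (?J ^\<^sub>m m * P)"
        using D by (intro assoc_mult_mat[of _ n n _ n _ n]) auto
      finally show ?thesis
        using D(6,7) jk pow_carrier_mat[OF D(5), of m] mult_carrier_mat[OF pow_carrier_mat[OF D(5), of m] D(7)]
        by (simp add: mult_mat_entry[of _ n n _ n] del: index_mult_mat)
    qed
    \<comment> \<open>Conjugation by the fixed matrices is a finite linear combination in every term
      of the series and hence commutes with summation.\<close>
    then have ser: "(\<lambda>m. complex_of_real ((A ^\<^sub>m m) $$ (j, k) / fact m * t ^ m)) =
        (\<lambda>m. \<Sum>a<n. Q $$ (j, a) * (\<Sum>b<n. ((?J ^\<^sub>m m) $$ (a, b) / fact m * of_real t ^ m) * P $$ (b, k)))"
      by (simp add: sum_distrib_left sum_distrib_right sum_divide_distrib mult_ac)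
    have "(\<lambda>m. complex_of_real ((A ^\<^sub>m m) $$ (j, k) / fact m * t ^ m)) sums
        (\<Sum>a<n. Q $$ (j, a) * (\<Sum>b<n. E $$ (a, b) * P $$ (b, k)))"
      unfolding ser by (intro sums_sum sums_mult sums_mult2 Esums) auto
    moreover have "(\<lambda>m. complex_of_real ((A ^\<^sub>m m) $$ (j, k) / fact m * t ^ m)) sums
        complex_of_real (mat_exp (t \<cdot>\<^sub>m A) $$ (j, k))"
      by (rule sums_of_real[OF mat_exp_entry_sums[OF A jk]])
    ultimately have "complex_of_real (mat_exp (t \<cdot>\<^sub>m A) $$ (j, k)) =
        (\<Sum>a<n. Q $$ (j, a) * (\<Sum>b<n. E $$ (a, b) * P $$ (b, k)))"
      by (rule sums_unique2[rotated])
    then show "cmat (mat_exp (t \<cdot>\<^sub>m A)) $$ (j, k) = (Q * (E * P)) $$ (j, k)"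
      using jk D(6,7) E A mat_exp_carrier[OF A, of t] mult_carrier_mat[OF E D(7)]
      by (simp add: mult_mat_entry[of _ n n _ n] del: index_mult_mat mat_exp_carrier)
  qed (use A D(6,7) E in \<open>auto simp: mat_exp_def\<close>)
  define u where "u = map_vec complex_of_real v"
  have u: "u \<in> carrier_vec n" using v by (simp add: u_def)
  have "vec_norm2 (mat_exp (t \<cdot>\<^sub>m A) *\<^sub>v v) = vec_norm2 (cmat (mat_exp (t \<cdot>\<^sub>m A)) *\<^sub>v u)"
    unfolding u_def of_real_hom.mult_mat_vec_hom[OF mat_exp_carrier[OF A] v, symmetric]
    by (simp add: vec_norm2_of_real)
  also have "\<dots> = vec_norm2 (Q *\<^sub>v (E *\<^sub>v (P *\<^sub>v u)))"
    unfolding eq using D(6,7) E u mult_carrier_mat[OF E D(7)] by (simp add: assoc_mult_mat_vec[of _ n n _ n])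
  also have "\<dots> \<le> mat_opnorm Q * vec_norm2 (E *\<^sub>v (P *\<^sub>v u))"
    using D(6,7) E u by (intro vec_norm2_mult_le_opnorm[of _ n n]) auto
  also have "\<dots> \<le> mat_opnorm Q * (real n * real n * exp t * vec_norm2 (P *\<^sub>v u))"
    using D(6,7) E u Ele by (intro mult_left_mono vec_norm2_mult_le_entries mat_opnorm_nonneg) auto
  also have "\<dots> \<le> mat_opnorm Q * (real n * real n * exp t * (mat_opnorm P * vec_norm2 u))"
    using D(6,7) u by (intro mult_left_mono vec_norm2_mult_le_opnorm[of _ n n] mat_opnorm_nonneg mult_nonneg_nonneg) auto
  also have "vec_norm2 u = vec_norm2 v" by (simp add: u_def vec_norm2_of_real)
  finally show ?thesis by (simp add: power2_eq_square mult_ac)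
qed

section \<open>A single component\<close>

lemma integrable_continuous_mult:
  fixes c h :: "real \<Rightarrow> real"
  assumes c: "continuous_on {a..b} c" and h: "integrable (lebesgue_on {a..b}) h"
  shows "integrable (lebesgue_on {a..b}) (\<lambda>s. c s * h s)"
proof -
  obtain B where B: "\<And>s. s \<in> {a..b} \<Longrightarrow> \<bar>c s\<bar> \<le> B"
    using compact_continuous_image[OF c] by (force dest!: compact_imp_bounded simp: bounded_iff)
  have "c \<in> borel_measurable (lebesgue_on {a..b})"
    using c by (intro continuous_imp_measurable_on_sets_lebesgue) auto
  then have "(\<lambda>s. c s * h s) \<in> borel_measurable (lebesgue_on {a..b})"
    using borel_measurable_integrable[OF h] by (intro borel_measurable_times)
  then show ?thesis
  proof (rule Bochner_Integration.integrable_bound[of _ "\<lambda>s. B * h s", rotated])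
    show "AE s in lebesgue_on {a..b}. norm (c s * h s) \<le> norm (B * h s)"
    proof (rule AE_I2)
      fix s assume "s \<in> space (lebesgue_on {a..b})"
      then have "\<bar>c s\<bar> \<le> \<bar>B\<bar>" using B[of s] by auto
      then show "norm (c s * h s) \<le> norm (B * h s)" by (simp add: abs_mult mult_right_mono)
    qed
  qed (use h in auto)
qed

text \<open>Cauchy-Schwarz against the constant 1. Integrability on the finite interval follows from
  |y| <= 1 + y^2.\<close>

lemma integral_squared_le:
  fixes f :: "real \<Rightarrow> real"
  assumes f: "f \<in> borel_measurable (lebesgue_on {0..T})"
    and f2: "integrable (lebesgue_on {0..T}) (\<lambda>s. (f s)\<^sup>2)" and T: "0 < T"
  shows "integrable (lebesgue_on {0..T}) f"
    and "(integral\<^sup>L (lebesgue_on {0..T}) f)\<^sup>2 \<le> T * integral\<^sup>L (lebesgue_on {0..T}) (\<lambda>s. (f s)\<^sup>2)"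
proof -
  let ?M = "lebesgue_on {0..T}"
  interpret finite_measure ?M by (rule finite_measure_lebesgue_on) auto
  have meas: "measure ?M (space ?M) = T"
    using T by (simp add: measure_restrict_space)
  show int: "integrable ?M f"
  proof (rule Bochner_Integration.integrable_bound[OF _ f])
    show "integrable ?M (\<lambda>s. 1 + (f s)\<^sup>2)"
      using f2 by (intro Bochner_Integration.integrable_add) auto
    have "\<bar>y\<bar> \<le> 1 + y\<^sup>2" for y :: real
      using zero_le_power2[of "\<bar>y\<bar> - 1"] by (simp add: power2_eq_square algebra_simps)
    then show "AE s in ?M. norm (f s) \<le> norm (1 + (f s)\<^sup>2)"
      by (intro AE_I2) (simp add: abs_of_nonneg)
  qed
  \<comment> \<open>The mean of f: the nonnegative integral of (f - m)^2 equals the integral of f^2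
    minus T * m^2, which is the claim up to a factor T.\<close>
  define m where "m = integral\<^sup>L ?M f / T"
  have "0 \<le> integral\<^sup>L ?M (\<lambda>s. (f s - m)\<^sup>2)"
    by (rule Bochner_Integration.integral_nonneg) auto
  also have "\<dots> = integral\<^sup>L ?M (\<lambda>s. (f s)\<^sup>2 + ((- 2 * m) * f s + m\<^sup>2))"
    by (simp add: power2_eq_square algebra_simps)
  also have "\<dots> = integral\<^sup>L ?M (\<lambda>s. (f s)\<^sup>2) + ((- 2 * m) * integral\<^sup>L ?M f + m\<^sup>2 * T)"
  proof -
    have "integrable ?M (\<lambda>s. (- 2 * m) * f s)" "integrable ?M (\<lambda>s. (- 2 * m) * f s + m\<^sup>2)"
      using int by auto
    then show ?thesis using f2 meas by (simp del: mult_minus_left)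
  qed
  also have "integral\<^sup>L ?M f = T * m" using T by (simp add: m_def)
  finally have "T * (T * m\<^sup>2) \<le> T * integral\<^sup>L ?M (\<lambda>s. (f s)\<^sup>2)"
    using T by (intro mult_left_mono) (simp_all add: power2_eq_square)
  moreover have "(integral\<^sup>L ?M f)\<^sup>2 = T * (T * m\<^sup>2)"
    using T by (simp add: m_def power2_eq_square)
  ultimately show "(integral\<^sup>L ?M f)\<^sup>2 \<le> T * integral\<^sup>L ?M (\<lambda>s. (f s)\<^sup>2)" by simp
qed

lemma vec_norm2_measurable:
  fixes W :: "'b \<Rightarrow> real vec"
  assumes W: "\<And>s. s \<in> space M \<Longrightarrow> W s \<in> carrier_vec n"
    and [measurable]: "\<And>j. j < n \<Longrightarrow> (\<lambda>s. W s $ j) \<in> borel_measurable M"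
  shows "(\<lambda>s. vec_norm2 (W s)) \<in> borel_measurable M"
proof -
  have "(\<lambda>s. sqrt (\<Sum>j<n. (norm (W s $ j))\<^sup>2)) \<in> borel_measurable M"
    by measurable
  then show ?thesis
    by (rule measurable_cong[THEN iffD2, rotated]) (simp add: vec_norm2_def L2_set_def carrier_vecD[OF W])
qed

text \<open>The system is uncoupled, so existence, uniqueness and the formula concern one component;
  \<open>W_square\<close> is what the summed control bound leaves for each. Only
  \<open>sol_bound\<close> has to be uniform in the index.\<close>

locale linear_ode =
  fixes n :: nat and A :: "real mat" and T :: real and W :: "real \<Rightarrow> real vec" and x0 :: "real vec"
  assumes A: "A \<in> carrier_mat n n" and T: "0 < T" and x0: "x0 \<in> carrier_vec n"
    and W: "\<And>s. s \<in> {0..T} \<Longrightarrow> W s \<in> carrier_vec n"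
    and W_measurable: "\<And>j. j < n \<Longrightarrow> (\<lambda>s. W s $ j) \<in> borel_measurable (lebesgue_on {0..T})"
    and W_square: "integrable (lebesgue_on {0..T}) (\<lambda>s. (vec_norm2 (W s))\<^sup>2)"
begin

abbreviation E :: "real \<Rightarrow> real mat" where "E t \<equiv> mat_exp (t \<cdot>\<^sub>m A)"

definition sol :: "real \<Rightarrow> real vec" where
  "sol t = E t *\<^sub>v x0 + vec_integral n 0 t (\<lambda>s. E (t - s) *\<^sub>v W s)"

text \<open>The variation-of-constants factor: \<open>sol t = E t *\<^sub>v fac t\<close>.\<close>

definition fac :: "real \<Rightarrow> nat \<Rightarrow> real" where
  "fac t k = x0 $ k + integral\<^sup>L (lebesgue_on {0..t}) (\<lambda>s. (E (- s) *\<^sub>v W s) $ k)"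

lemma E_carrier: "E t \<in> carrier_mat n n"
  using A by (rule mat_exp_carrier)

lemma E_W_entry:
  assumes "s \<in> {0..T}" "k < n"
  shows "(E t *\<^sub>v W s) $ k = (\<Sum>l<n. E t $$ (k, l) * W s $ l)"
  using mult_mat_vec_entry[OF E_carrier W assms(2)] assms(1) .

lemma vec_norm2_W_measurable: "(\<lambda>s. vec_norm2 (W s)) \<in> borel_measurable (lebesgue_on {0..T})"
  using W W_measurable by (intro vec_norm2_measurable) auto

lemma W_integrable:
  assumes "j < n"
  shows "integrable (lebesgue_on {0..T}) (\<lambda>s. W s $ j)"
proof (rule Bochner_Integration.integrable_bound)
  show "integrable (lebesgue_on {0..T}) (\<lambda>s. vec_norm2 (W s))"
    using integral_squared_le(1)[OF vec_norm2_W_measurable W_square T] .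
  show "AE s in lebesgue_on {0..T}. norm (W s $ j) \<le> norm (vec_norm2 (W s))"
    using vec_norm2_entry_le[of j "W _"] assms by (intro AE_I2) (auto simp: carrier_vecD[OF W])
qed (rule W_measurable[OF assms])

text \<open>The free c serves two kernels: c = t in the solution formula and c = 0 in
  \<open>fac\<close>.\<close>

lemma E_W_integrable:
  assumes k: "k < n" and t: "t \<le> T"
  shows "integrable (lebesgue_on {0..t}) (\<lambda>s. (E (c - s) *\<^sub>v W s) $ k)"
proof -
  have "continuous_on {0..T} (\<lambda>s. E (c - s) $$ (k, l))" if "l < n" for l
    by (rule continuous_on_compose2[OF continuous_on_mat_exp_entry[OF A k that, of UNIV]])
      (auto intro!: continuous_intros)
  then have "integrable (lebesgue_on {0..T}) (\<lambda>s. \<Sum>l<n. E (c - s) $$ (k, l) * W s $ l)"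
    by (intro Bochner_Integration.integrable_sum integrable_continuous_mult W_integrable) auto
  moreover have "integrable (lebesgue_on {0..T}) (\<lambda>s. (E (c - s) *\<^sub>v W s) $ k) \<longleftrightarrow>
      integrable (lebesgue_on {0..T}) (\<lambda>s. \<Sum>l<n. E (c - s) $$ (k, l) * W s $ l)"
    by (rule Bochner_Integration.integrable_cong) (simp_all add: E_W_entry k del: index_mult_mat_vec)
  ultimately have "integrable (lebesgue_on {0..T}) (\<lambda>s. (E (c - s) *\<^sub>v W s) $ k)" by simp
  then show ?thesis
    by (rule integrable_lebesgue_on_subinterval) (use t in auto)
qed

lemma vec_integrable_E_W: "t \<le> T \<Longrightarrow> vec_integrable n 0 t (\<lambda>s. E (t - s) *\<^sub>v W s)"
  by (simp add: vec_integrable_def E_W_integrable)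

lemma sol_carrier: "sol t \<in> carrier_vec n"
  using E_carrier[of t] x0 by (auto simp: sol_def vec_integral_def)

lemma E_mult_minus: "v \<in> carrier_vec n \<Longrightarrow> E t *\<^sub>v (E (- t) *\<^sub>v v) = v"
  using mat_exp_mult[OF A, of t "- t"] mat_exp_0[OF A]
    assoc_mult_mat_vec[OF E_carrier E_carrier, of v t "- t"] by simp

text \<open>In the formula t occurs both as integration limit and inside the kernel. Writing E (t -
  s) as E t times E (- s) takes it out of the integrand, so that differentiation only has to treat
  an indefinite integral and a smooth factor.\<close>

lemma sol_entry:
  assumes t: "t \<le> T" and j: "j < n"
  shows "sol t $ j = (\<Sum>k<n. E t $$ (j, k) * fac t k)"
proof -
  have "(E (t - s) *\<^sub>v W s) $ j = (\<Sum>k<n. E t $$ (j, k) * (E (- s) *\<^sub>v W s) $ k)"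
    if s: "s \<in> {0..t}" for s
  proof -
    have Ws: "W s \<in> carrier_vec n" using s t by (intro W) auto
    have "E (t - s) *\<^sub>v W s = E t *\<^sub>v (E (- s) *\<^sub>v W s)"
      using mat_exp_mult[OF A, of t "- s"] assoc_mult_mat_vec[OF E_carrier E_carrier Ws, of t "- s"]
      by simp
    then show ?thesis
      using mult_mat_vec_entry[OF E_carrier mult_mat_vec_carrier[OF E_carrier Ws] j, of t "- s"] by simp
  qed
  then have "integral\<^sup>L (lebesgue_on {0..t}) (\<lambda>s. (E (t - s) *\<^sub>v W s) $ j) =
      integral\<^sup>L (lebesgue_on {0..t}) (\<lambda>s. \<Sum>k<n. E t $$ (j, k) * (E (- s) *\<^sub>v W s) $ k)"
    by (intro Bochner_Integration.integral_cong) auto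
  also have "\<dots> = (\<Sum>k<n. E t $$ (j, k) * integral\<^sup>L (lebesgue_on {0..t}) (\<lambda>s. (E (- s) *\<^sub>v W s) $ k))"
    using E_W_integrable[OF _ t, of _ 0]
    by (subst Bochner_Integration.integral_sum) auto
  finally show ?thesis
    using j mult_mat_vec_entry[OF E_carrier x0 j, of t] E_carrier[of t] x0
    by (simp add: sol_def vec_integral_def fac_def sum.distrib distrib_left del: index_mult_mat_vec)
qed

lemma sol_0: "sol 0 = x0"
proof (rule eq_vecI)
  fix j assume "j < dim_vec x0"
  then have j: "j < n" using x0 by auto
  have "integral\<^sup>L (lebesgue_on {0..0}) (\<lambda>s. (E (- s) *\<^sub>v W s) $ k) = 0" if "k < n" for k
  proof -
    have "integrable (lebesgue_on {0..0}) (\<lambda>s. (E (- s) *\<^sub>v W s) $ k)"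
      using E_W_integrable[OF that, of 0 0] T by simp
    then have "integral\<^sup>L (lebesgue_on {0..0}) (\<lambda>s. (E (- s) *\<^sub>v W s) $ k) =
        integral {0..0} (\<lambda>s. (E (- s) *\<^sub>v W s) $ k)"
      by (intro integral_unique[symmetric] has_integral_integral_lebesgue_on) auto
    also have "\<dots> = 0"
      by (rule integral_unique) (simp add: has_integral_refl)
    finally show ?thesis .
  qed
  then have "sol 0 $ j = (E 0 *\<^sub>v x0) $ j"
    using j T by (simp add: sol_entry fac_def mult_mat_vec_entry[OF E_carrier x0 j] del: index_mult_mat_vec)
  then show "sol 0 $ j = x0 $ j"
    using x0 by (simp add: mat_exp_0[OF A])
qed (use sol_carrier[of 0] x0 in auto)

lemma E_abs_continuous:
  assumes "j < n" "k < n"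
  shows "abs_continuous_on_interval 0 T (\<lambda>t. E t $$ (j, k))"
  using assms
  by (intro abs_continuous_C1[OF mat_exp_has_derivative(1)[OF A]] continuous_on_sum continuous_on_mult
      continuous_on_const continuous_on_mat_exp_entry[OF A]) auto

lemma sol_abs_continuous:
  assumes "j < n"
  shows "abs_continuous_on_interval 0 T (\<lambda>t. sol t $ j)"
proof -
  have "abs_continuous_on_interval 0 T (\<lambda>t. \<Sum>k<n. E t $$ (j, k) * fac t k)"
    unfolding fac_def using assms E_W_integrable[of _ T 0]
    by (intro abs_continuous_sum abs_continuous_mult E_abs_continuous abs_continuous_add
        abs_continuous_const abs_continuous_primitive) auto
  then show ?thesis
    by (rule abs_continuous_cong[THEN iffD2, rotated]) (use assms in \<open>auto simp: sol_entry\<close>)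
qed

text \<open>By the product rule, differentiating E t gives A times the solution, and differentiating
  \<open>fac\<close> gives E t (E (- t) W t) = W t.\<close>

lemma sol_has_derivative:
  "AE t in lebesgue_on {0..T}. \<forall>j<n. ((\<lambda>s. sol s $ j) has_real_derivative (A *\<^sub>v sol t + W t) $ j) (at t within {0..T})"
proof -
  have "AE t in lebesgue_on {0..T}. \<forall>k\<in>{..<n}.
      ((\<lambda>t. fac t k) has_real_derivative (E (- t) *\<^sub>v W t) $ k) (at t within {0..T})"
  proof (rule AE_finite_allI)
    fix k assume "k \<in> {..<n}"
    then have "integrable (lebesgue_on {0..T}) (\<lambda>s. (E (- s) *\<^sub>v W s) $ k)"
      using E_W_integrable[of k T 0] by simp
    from AE_primitive_has_derivative[OF this]
    show "AE t in lebesgue_on {0..T}.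
        ((\<lambda>t. fac t k) has_real_derivative (E (- t) *\<^sub>v W t) $ k) (at t within {0..T})"
      by eventually_elim (auto simp: fac_def intro!: derivative_eq_intros)
  qed auto
  then show ?thesis
  proof (rule lebesgue_on_mono, intro allI impI)
    fix t j
    assume D: "\<forall>k\<in>{..<n}. ((\<lambda>t. fac t k) has_real_derivative (E (- t) *\<^sub>v W t) $ k) (at t within {0..T})"
      and t: "t \<in> {0..T}" and j: "j < n"
    have Wt: "W t \<in> carrier_vec n" using t by (rule W)
    have "((\<lambda>t. \<Sum>k<n. E t $$ (j, k) * fac t k) has_real_derivative
        (\<Sum>k<n. (\<Sum>l<n. A $$ (j, l) * E t $$ (l, k)) * fac t k + (E (- t) *\<^sub>v W t) $ k * E t $$ (j, k)))
        (at t within {0..T})"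
      using D j by (intro DERIV_sum DERIV_mult DERIV_subset[OF mat_exp_has_derivative(1)[OF A]]) auto
    also have "(\<Sum>k<n. (\<Sum>l<n. A $$ (j, l) * E t $$ (l, k)) * fac t k + (E (- t) *\<^sub>v W t) $ k * E t $$ (j, k)) =
        (\<Sum>k<n. \<Sum>l<n. A $$ (j, l) * E t $$ (l, k) * fac t k) + (\<Sum>k<n. E t $$ (j, k) * (E (- t) *\<^sub>v W t) $ k)"
      by (simp add: sum.distrib sum_distrib_left sum_distrib_right mult_ac del: index_mult_mat_vec)
    also have "(\<Sum>k<n. E t $$ (j, k) * (E (- t) *\<^sub>v W t) $ k) = W t $ j"
      using mult_mat_vec_entry[OF E_carrier mult_mat_vec_carrier[OF E_carrier Wt] j, of t "- t"]
        E_mult_minus[OF Wt, of t] by simp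
    also have "(\<Sum>k<n. \<Sum>l<n. A $$ (j, l) * E t $$ (l, k) * fac t k) = (\<Sum>l<n. A $$ (j, l) * sol t $ l)"
      using t by (subst sum.swap) (simp add: sol_entry sum_distrib_left mult.assoc)
    also have "\<dots> = (A *\<^sub>v sol t) $ j"
      using mult_mat_vec_entry[OF A sol_carrier j] by simp
    also have "(A *\<^sub>v sol t) $ j + W t $ j = (A *\<^sub>v sol t + W t) $ j"
      using A Wt j by simp
    finally show "((\<lambda>s. sol s $ j) has_real_derivative (A *\<^sub>v sol t + W t) $ j) (at t within {0..T})"
      \<comment> \<open>The representation by \<open>fac\<close> is available only up to T, which
        suffices for a derivative within {0..T}; the radius 1 is arbitrary.\<close>
      by (rule has_field_derivative_transform_within[where d = 1]) (use t j in \<open>auto simp: sol_entry\<close>)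
  qed
qed

lemma sol_unique:
  assumes y: "\<And>t. t \<in> {0..T} \<Longrightarrow> y t \<in> carrier_vec n"
    and ac: "\<And>j. j < n \<Longrightarrow> abs_continuous_on_interval 0 T (\<lambda>t. y t $ j)"
    and der: "AE t in lebesgue_on {0..T}. \<forall>j<n.
      ((\<lambda>s. y s $ j) has_real_derivative (A *\<^sub>v y t + W t) $ j) (at t within {0..T})"
    and init: "y 0 = x0" and t: "t \<in> {0..T}"
  shows "y t = sol t"
proof -
  define \<Delta> where "\<Delta> t k = y t $ k - sol t $ k" for t k
  \<comment> \<open>The vector with coordinates \<open>Z j t\<close> is E (- t) applied to the
    difference of the two solutions.\<close>
  define Z where "Z j t = (\<Sum>k<n. E (- t) $$ (j, k) * \<Delta> t k)" for j t
  have Em_der: "((\<lambda>t. E (- t) $$ (j, k)) has_real_derivative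
      - (\<Sum>l<n. E (- t) $$ (j, l) * A $$ (l, k))) (at t)" if "j < n" "k < n" for j k t
    using DERIV_chain2[OF mat_exp_has_derivative(2)[OF A that] DERIV_minus[OF DERIV_ident]] by simp
  have Z_ac: "abs_continuous_on_interval 0 T (Z j)" if j: "j < n" for j
    unfolding Z_def
  proof (intro abs_continuous_sum abs_continuous_mult)
    fix k assume k: "k \<in> {..<n}"
    have cont: "continuous_on {0..T} (\<lambda>t. E (- t) $$ (j, l))" if "l < n" for l
      by (rule continuous_on_compose2[OF continuous_on_mat_exp_entry[OF A j that, of UNIV]])
        (auto intro!: continuous_intros)
    show "abs_continuous_on_interval 0 T (\<lambda>t. E (- t) $$ (j, k))"
      using j k cont by (intro abs_continuous_C1[OF Em_der] continuous_intros) auto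
    have "abs_continuous_on_interval 0 T (\<lambda>t. y t $ k + (- 1) * sol t $ k)"
      using k by (intro abs_continuous_add abs_continuous_mult abs_continuous_const ac sol_abs_continuous) auto
    then show "abs_continuous_on_interval 0 T (\<lambda>t. \<Delta> t k)" by (simp add: \<Delta>_def)
  qed
  have Z_der: "AE t in lebesgue_on {0..T}. (Z j has_real_derivative 0) (at t within {0..T})" if j: "j < n" for j
  proof -
    have "AE t in lebesgue_on {0..T}. \<forall>k<n.
        ((\<lambda>s. \<Delta> s k) has_real_derivative ((A *\<^sub>v y t + W t) $ k - (A *\<^sub>v sol t + W t) $ k)) (at t within {0..T})"
      using der sol_has_derivative
      by eventually_elim (auto simp: \<Delta>_def intro!: DERIV_diff)
    then show ?thesis
    proof (rule lebesgue_on_mono)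
      fix t assume D: "\<forall>k<n. ((\<lambda>s. \<Delta> s k) has_real_derivative
          ((A *\<^sub>v y t + W t) $ k - (A *\<^sub>v sol t + W t) $ k)) (at t within {0..T})" and t: "t \<in> {0..T}"
      \<comment> \<open>The control cancels, so the difference solves the homogeneous equation
        almost everywhere.\<close>
      have eq: "(A *\<^sub>v y t + W t) $ k - (A *\<^sub>v sol t + W t) $ k = (\<Sum>l<n. A $$ (k, l) * \<Delta> t l)" if k: "k < n" for k
      proof -
        have "(A *\<^sub>v y t + W t) $ k = (\<Sum>l<n. A $$ (k, l) * y t $ l) + W t $ k"
          "(A *\<^sub>v sol t + W t) $ k = (\<Sum>l<n. A $$ (k, l) * sol t $ l) + W t $ k"
          using mult_mat_vec_entry[OF A y[OF t] k] mult_mat_vec_entry[OF A sol_carrier k, of t] W[OF t] A k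
          by (auto simp del: index_mult_mat_vec)
        then show ?thesis by (simp add: \<Delta>_def right_diff_distrib sum_subtractf)
      qed
      have "((\<lambda>t. \<Sum>k<n. E (- t) $$ (j, k) * \<Delta> t k) has_real_derivative
          (\<Sum>k<n. - (\<Sum>l<n. E (- t) $$ (j, l) * A $$ (l, k)) * \<Delta> t k
            + (\<Sum>l<n. A $$ (k, l) * \<Delta> t l) * E (- t) $$ (j, k))) (at t within {0..T})"
        using D eq j by (intro DERIV_sum DERIV_mult DERIV_subset[OF Em_der]) auto
      \<comment> \<open>Both sums are E (- t) A applied to the difference, one from each factor of
        the product rule, and they occur with opposite signs.\<close>
      moreover have "(\<Sum>k<n. (\<Sum>l<n. E (- t) $$ (j, l) * A $$ (l, k)) * \<Delta> t k) =
          (\<Sum>k<n. (\<Sum>l<n. A $$ (k, l) * \<Delta> t l) * E (- t) $$ (j, k))"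
        unfolding sum_distrib_right by (subst sum.swap) (simp add: mult_ac)
      ultimately show "(Z j has_real_derivative 0) (at t within {0..T})"
        unfolding Z_def[abs_def] by (simp add: sum_subtractf)
    qed
  qed
  have "Z j t = 0" if j: "j < n" for j
  proof -
    have "Z j t = Z j 0"
      using abs_continuous_zero_derivative_const[OF Z_ac[OF j] Z_der[OF j] t] .
    also have "\<dots> = 0" by (simp add: Z_def \<Delta>_def init sol_0)
    finally show ?thesis .
  qed
  then have "E (- t) *\<^sub>v (y t - sol t) = 0\<^sub>v n"
    using E_carrier[of "- t"] y[OF t] sol_carrier[of t] mult_mat_vec_entry[OF E_carrier[of "- t"], of "y t - sol t"]
    by (intro eq_vecI) (auto simp: Z_def \<Delta>_def simp del: index_mult_mat_vec)
  \<comment> \<open>E t undoes E (- t), so the difference itself vanishes.\<close>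
  then have "E t *\<^sub>v (E (- t) *\<^sub>v (y t - sol t)) = 0\<^sub>v n"
    using E_carrier[of t] by (auto simp: scalar_prod_def)
  then have "y t - sol t = 0\<^sub>v n"
    using E_mult_minus[of "y t - sol t" t] y[OF t] sol_carrier[of t] by simp
  then have "(y t - sol t) $ j = 0" if "j < n" for j using that by simp
  then show ?thesis
    using y[OF t] sol_carrier[of t] by (intro eq_vecI) auto
qed

text \<open>Combines (a + b)^2 <= 2 a^2 + 2 b^2 with Cauchy-Schwarz in time. The right side is free
  of t, so it can serve as a majorant on the whole interval; n^2 arises from estimating the integral
  coordinate by coordinate.\<close>

lemma sol_bound:
  assumes K: "\<And>t v. t \<in> {0..T} \<Longrightarrow> v \<in> carrier_vec n \<Longrightarrow> vec_norm2 (E t *\<^sub>v v) \<le> K * vec_norm2 v"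
    and "0 \<le> K" and t: "t \<in> {0..T}"
  shows "(vec_norm2 (sol t))\<^sup>2 \<le> 2 * K\<^sup>2 * (vec_norm2 x0)\<^sup>2
      + 2 * (real n)\<^sup>2 * K\<^sup>2 * T * integral\<^sup>L (lebesgue_on {0..T}) (\<lambda>s. (vec_norm2 (W s))\<^sup>2)"
proof -
  let ?I = "vec_integral n 0 t (\<lambda>s. E (t - s) *\<^sub>v W s)"
  let ?N = "\<lambda>s. vec_norm2 (W s)"
  have N: "integrable (lebesgue_on {0..T}) ?N"
    "(integral\<^sup>L (lebesgue_on {0..T}) ?N)\<^sup>2 \<le> T * integral\<^sup>L (lebesgue_on {0..T}) (\<lambda>s. (?N s)\<^sup>2)"
    using integral_squared_le[OF vec_norm2_W_measurable W_square T] .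
  have Nt: "integrable (lebesgue_on {0..t}) ?N"
    by (rule integrable_lebesgue_on_subinterval[OF N(1)]) (use t in auto)
  have comp: "\<bar>?I $ j\<bar> \<le> K * integral\<^sup>L (lebesgue_on {0..T}) ?N" if j: "j < n" for j
  proof -
    have "\<bar>?I $ j\<bar> \<le> integral\<^sup>L (lebesgue_on {0..t}) (\<lambda>s. \<bar>(E (t - s) *\<^sub>v W s) $ j\<bar>)"
      using j integral_norm_bound[of "lebesgue_on {0..t}" "\<lambda>s. (E (t - s) *\<^sub>v W s) $ j"]
      by (simp add: vec_integral_def del: index_mult_mat_vec)
    also have "\<dots> \<le> integral\<^sup>L (lebesgue_on {0..t}) (\<lambda>s. K * ?N s)"
    proof (rule integral_mono)
      show "integrable (lebesgue_on {0..t}) (\<lambda>s. \<bar>(E (t - s) *\<^sub>v W s) $ j\<bar>)"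
        using E_W_integrable[OF j, of t t] t by (intro integrable_abs) auto
      fix s assume s: "s \<in> space (lebesgue_on {0..t})"
      have Ws: "W s \<in> carrier_vec n" using s t by (intro W) auto
      have "\<bar>(E (t - s) *\<^sub>v W s) $ j\<bar> \<le> vec_norm2 (E (t - s) *\<^sub>v W s)"
        using vec_norm2_entry_le[of j "E (t - s) *\<^sub>v W s"] carrier_vecD[OF mult_mat_vec_carrier[OF E_carrier Ws, of "t - s"]] j
        by (simp del: index_mult_mat_vec dim_mult_mat_vec)
      \<comment> \<open>Here 0 <= s <= t, so t - s lies in [0,T], where the bound K is
        assumed.\<close>
      also have "\<dots> \<le> K * ?N s" using s t by (intro K Ws) auto
      finally show "\<bar>(E (t - s) *\<^sub>v W s) $ j\<bar> \<le> K * ?N s" .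
    qed (use Nt in auto)
    also have "\<dots> = K * integral\<^sup>L (lebesgue_on {0..t}) ?N" by simp
    also have "\<dots> \<le> K * integral\<^sup>L (lebesgue_on {0..T}) ?N"
      using \<open>0 \<le> K\<close> t by (intro mult_left_mono integral_mono_lebesgue_on_AE[OF N(1)]) auto
    finally show ?thesis .
  qed
  have I: "?I \<in> carrier_vec n" by (simp add: vec_integral_def)
  have "vec_norm2 ?I \<le> (\<Sum>j<n. K * integral\<^sup>L (lebesgue_on {0..T}) ?N)"
  proof (rule order.trans[OF vec_norm2_le_sum])
    show "(\<Sum>j<dim_vec ?I. norm (?I $ j)) \<le> (\<Sum>j<n. K * integral\<^sup>L (lebesgue_on {0..T}) ?N)"
      unfolding carrier_vecD[OF I] by (rule sum_mono) (simp add: comp)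
  qed
  then have "(vec_norm2 ?I)\<^sup>2 \<le> (real n * K * integral\<^sup>L (lebesgue_on {0..T}) ?N)\<^sup>2"
    by (intro power_mono) auto
  also have "\<dots> = (real n)\<^sup>2 * K\<^sup>2 * (integral\<^sup>L (lebesgue_on {0..T}) ?N)\<^sup>2"
    by (simp add: power_mult_distrib)
  also have "\<dots> \<le> (real n)\<^sup>2 * K\<^sup>2 * (T * integral\<^sup>L (lebesgue_on {0..T}) (\<lambda>s. (?N s)\<^sup>2))"
    using N(2) by (intro mult_left_mono) auto
  finally have 2: "(vec_norm2 ?I)\<^sup>2 \<le> (real n)\<^sup>2 * K\<^sup>2 * (T * integral\<^sup>L (lebesgue_on {0..T}) (\<lambda>s. (?N s)\<^sup>2))" .
  have 1: "(vec_norm2 (E t *\<^sub>v x0))\<^sup>2 \<le> K\<^sup>2 * (vec_norm2 x0)\<^sup>2"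
    using power_mono[OF K[OF t x0], of 2] by (simp add: power_mult_distrib)
  have "(vec_norm2 (sol t))\<^sup>2 \<le> (vec_norm2 (E t *\<^sub>v x0) + vec_norm2 ?I)\<^sup>2"
    unfolding sol_def
    using I mult_mat_vec_carrier[OF E_carrier x0, of t] by (intro power_mono vec_norm2_add_le) auto
  also have "\<dots> \<le> 2 * (vec_norm2 (E t *\<^sub>v x0))\<^sup>2 + 2 * (vec_norm2 ?I)\<^sup>2"
    using sum_squares_bound[of "vec_norm2 (E t *\<^sub>v x0)" "vec_norm2 ?I"]
    by (simp add: power2_eq_square algebra_simps)
  finally show ?thesis using 1 2 by (simp add: mult.assoc)
qed

end

section \<open>The infinite system\<close>

lemma vec_norm2_square: "(vec_norm2 v)\<^sup>2 = (\<Sum>j<dim_vec v. (norm (v $ j))\<^sup>2)"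
  by (simp add: vec_norm2_def L2_set_def sum_nonneg)

lemma vec_norm2_diff_square_le:
  assumes "u \<in> carrier_vec n" "v \<in> carrier_vec n"
  shows "(vec_norm2 (u - v))\<^sup>2 \<le> 2 * (vec_norm2 u)\<^sup>2 + 2 * (vec_norm2 v)\<^sup>2"
proof -
  have "u - v = u + (- 1) \<cdot>\<^sub>v v" using assms by (intro eq_vecI) auto
  then have "vec_norm2 (u - v) \<le> vec_norm2 u + vec_norm2 v"
    using vec_norm2_add_le[of u n "(- 1) \<cdot>\<^sub>v v"] assms by (simp add: vec_norm2_smult)
  then have "(vec_norm2 (u - v))\<^sup>2 \<le> (vec_norm2 u + vec_norm2 v)\<^sup>2"
    by (intro power_mono) auto
  also have "\<dots> \<le> 2 * (vec_norm2 u)\<^sup>2 + 2 * (vec_norm2 v)\<^sup>2"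
    using sum_squares_bound[of "vec_norm2 u" "vec_norm2 v"]
    by (simp add: power2_eq_square algebra_simps)
  finally show ?thesis .
qed

text \<open>The dependence on i in \<open>mat_exp_norm_bound\<close> sits in the product of the
  norms and in the dimension, which C and D control.\<close>

lemma mat_exp_uniform_bound:
  assumes d: "\<And>i. d i \<le> D" and A: "\<And>i. A i \<in> carrier_mat (d i) (d i)"
    and norm: "uniformly_normalizable A"
    and ev: "\<And>i \<mu>. eigenvalue (cmat (A i)) \<mu> \<Longrightarrow> Re \<mu> \<le> 0"
  obtains K where "0 \<le> K" "\<And>i t v. t \<in> {0..T} \<Longrightarrow> v \<in> carrier_vec (d i) \<Longrightarrow>
      vec_norm2 (mat_exp (t \<cdot>\<^sub>m A i) *\<^sub>v v) \<le> K * vec_norm2 v"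
proof -
  obtain P C where C: "1 \<le> C" and P: "\<And>i. \<exists>Q js. similar_mat_wit (jordan_matrix js) (cmat (A i)) (P i) Q \<and>
        mat_opnorm (P i) * mat_opnorm Q \<le> C"
    using norm unfolding uniformly_normalizable_def by metis
  show thesis
  proof
    show "0 \<le> C * (real D)\<^sup>2 * exp T" using C by simp
    fix i :: nat and t :: real and v :: "real vec"
    assume t: "t \<in> {0..T}" and v: "v \<in> carrier_vec (d i)"
    obtain Q js where Q: "similar_mat_wit (jordan_matrix js) (cmat (A i)) (P i) Q"
      "mat_opnorm (P i) * mat_opnorm Q \<le> C"
      using P by blast
    have "vec_norm2 (mat_exp (t \<cdot>\<^sub>m A i) *\<^sub>v v) \<le>
        mat_opnorm (P i) * mat_opnorm Q * (real (d i))\<^sup>2 * exp t * vec_norm2 v"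
      using t by (intro mat_exp_norm_bound[OF A v _ Q(1) ev]) auto
    also have "\<dots> \<le> C * (real D)\<^sup>2 * exp T * vec_norm2 v"
      using Q(2) C d[of i] t
      by (intro mult_right_mono mult_mono power_mono) auto
    finally show "vec_norm2 (mat_exp (t \<cdot>\<^sub>m A i) *\<^sub>v v) \<le> C * (real D)\<^sup>2 * exp T * vec_norm2 v" .
  qed
qed

text \<open>The control bound is a sum of nonnegative integrals with values in
  \<open>ennreal\<close>. Its finiteness makes each term finite, and then the terms can be read as
  real integrals forming a summable sequence.\<close>

lemma admissible_controls_square_integrable:
  assumes w: "w \<in> admissible_controls d T \<theta>"
  shows "integrable (lebesgue_on {0..T}) (\<lambda>s. (vec_norm2 (w s i))\<^sup>2)"
    and "summable (\<lambda>i. integral\<^sup>L (lebesgue_on {0..T}) (\<lambda>s. (vec_norm2 (w s i))\<^sup>2))"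
proof -
  let ?M = "lebesgue_on {0..T}"
  have meas: "(\<lambda>s. vec_norm2 (w s i)) \<in> borel_measurable ?M" for i
    using w by (intro vec_norm2_measurable[of _ _ "d i"]) (auto simp: admissible_controls_def ell2_def Pi_iff)
  have fin: "(\<Sum>i. \<integral>\<^sup>+ s. ennreal ((vec_norm2 (w s i))\<^sup>2) \<partial>?M) < \<infinity>"
    using w by (auto simp: admissible_controls_def intro: le_less_trans)
  then have "(\<integral>\<^sup>+ s. ennreal ((vec_norm2 (w s i))\<^sup>2) \<partial>?M) < \<infinity>" for i
    by (rule ennreal_suminf_lessD)
  then show int: "integrable ?M (\<lambda>s. (vec_norm2 (w s i))\<^sup>2)" for i
    using meas[of i] by (intro integrableI_nonneg) auto
  have "(\<integral>\<^sup>+ s. ennreal ((vec_norm2 (w s i))\<^sup>2) \<partial>?M)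
      = ennreal (integral\<^sup>L ?M (\<lambda>s. (vec_norm2 (w s i))\<^sup>2))" for i
    by (intro nn_integral_eq_integral int) auto
  then show "summable (\<lambda>i. integral\<^sup>L ?M (\<lambda>s. (vec_norm2 (w s i))\<^sup>2))"
    using fin by (intro summable_suminf_not_top) auto
qed

text \<open>Coordinatewise continuity does not give continuity in the norm; the summable majorant
  allows the limit to be taken inside the series by Tannery's theorem.\<close>

lemma continuous_ell2I:
  assumes carrier: "\<And>t i. t \<in> {0..T} \<Longrightarrow> X t i \<in> carrier_vec (d i)"
    and cont: "\<And>i j. j < d i \<Longrightarrow> continuous_on {0..T} (\<lambda>t. X t i $ j)"
    and bound: "\<And>t i. t \<in> {0..T} \<Longrightarrow> (vec_norm2 (X t i))\<^sup>2 \<le> b i" and b: "summable b"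
  shows "restrict X {0..T} \<in> continuous_ell2 d T"
proof -
  have "X t \<in> ell2 d" if "t \<in> {0..T}" for t
    using carrier[OF that] bound[OF that] summable_comparison_test'[OF b, of 0 "\<lambda>i. (vec_norm2 (X t i))\<^sup>2"]
    by (auto simp: ell2_def)
  moreover have "((\<lambda>s. ell2_dist (restrict X {0..T} s) (restrict X {0..T} t)) \<longlongrightarrow> 0) (at t within {0..T})"
    if t: "t \<in> {0..T}" for t
  \<comment> \<open>Tannery's theorem asks for a nontrivial filter; the filter is trivial when
    {0..T} is a single point, and then every limit holds.\<close>
  proof (cases "at t within {0..T} = bot")
    case False
    let ?a = "\<lambda>i s. (vec_norm2 (X s i - X t i))\<^sup>2"
    have "((\<lambda>s. \<Sum>i. ?a i s) \<longlongrightarrow> (\<Sum>i :: nat. 0)) (at t within {0..T})"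
    proof (rule tannerys_theorem[THEN conjunct2, THEN conjunct2])
      fix i
      have "((\<lambda>s. \<Sum>j<d i. (norm (X s i $ j - X t i $ j))\<^sup>2) \<longlongrightarrow> (\<Sum>j<d i. (norm (X t i $ j - X t i $ j))\<^sup>2))
          (at t within {0..T})"
        using cont t by (intro tendsto_intros) (auto simp: continuous_on_def)
      then show "(?a i \<longlongrightarrow> 0) (at t within {0..T})"
        using carrier[OF t, of i] by (simp add: vec_norm2_square)
    next
      have "eventually (\<lambda>s. s \<in> {0..T}) (at t within {0..T})"
        by (auto simp: eventually_at_filter)
      moreover have "norm (?a i s) \<le> 4 * b i" if "s \<in> {0..T}" for i s
        using vec_norm2_diff_square_le[OF carrier carrier, OF that t, of i] bound[OF that, of i] bound[OF t, of i]
        by simp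
      ultimately show "eventually (\<lambda>(i, s). norm (?a i s) \<le> 4 * b i) (at_top \<times>\<^sub>F (at t within {0..T}))"
        unfolding eventually_prod_filter
        by (intro exI[of _ "\<lambda>_. True"] exI[of _ "\<lambda>s. s \<in> {0..T}"]) auto
      show "summable (\<lambda>i. 4 * b i)" using b by (rule summable_mult)
    qed (rule False)
    then have "((\<lambda>s. sqrt (\<Sum>i. ?a i s)) \<longlongrightarrow> 0) (at t within {0..T})"
      using tendsto_real_sqrt by fastforce
    then show ?thesis
      by (rule Lim_transform_within[where d = 1]) (use t in \<open>auto simp: ell2_dist_def\<close>)
  qed simp
  ultimately show ?thesis
    by (auto simp: continuous_ell2_def)
qed

theorem theorem1:
  fixes D :: nat and d :: "nat \<Rightarrow> nat" and A :: "nat \<Rightarrow> real mat" and T :: real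
  assumes "2 \<le> D"
    and "\<And>i. 2 \<le> d i \<and> d i \<le> D"
    and "\<And>i. A i \<in> carrier_mat (d i) (d i)"
    and "0 < T"
    and "uniformly_normalizable A"
    and "\<And>i \<mu>. eigenvalue (cmat (A i)) \<mu> \<Longrightarrow> Re \<mu> < 0"
  shows "\<forall>\<theta>>0. \<forall>w \<in> admissible_controls d T \<theta>. \<forall>x0 \<in> ell2 d.
    (\<exists>!x. is_solution d T A w x0 x) \<and>
    (\<forall>x. is_solution d T A w x0 x \<longrightarrow>
      (\<forall>i. \<forall>t\<in>{0..T}.
        vec_integrable (d i) 0 t (\<lambda>s. mat_exp ((t - s) \<cdot>\<^sub>m A i) *\<^sub>v w s i) \<and>
        x t i = mat_exp (t \<cdot>\<^sub>m A i) *\<^sub>v x0 i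
          + vec_integral (d i) 0 t (\<lambda>s. mat_exp ((t - s) \<cdot>\<^sub>m A i) *\<^sub>v w s i)))"
proof (intro allI impI ballI)
  fix \<theta> w x0
  assume w: "w \<in> admissible_controls d T \<theta>" and x0: "x0 \<in> ell2 d"
  obtain K where K: "0 \<le> K" "\<And>i t v. t \<in> {0..T} \<Longrightarrow> v \<in> carrier_vec (d i) \<Longrightarrow>
      vec_norm2 (mat_exp (t \<cdot>\<^sub>m A i) *\<^sub>v v) \<le> K * vec_norm2 v"
    using mat_exp_uniform_bound[of d D A T] assms(2,3,5) less_imp_le[OF assms(6)] by metis
  define q where "q i = integral\<^sup>L (lebesgue_on {0..T}) (\<lambda>s. (vec_norm2 (w s i))\<^sup>2)" for i
  have ode: "linear_ode (d i) (A i) T (\<lambda>s. w s i) (x0 i)" for i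
    using w x0 assms(3)[of i] \<open>0 < T\<close> admissible_controls_square_integrable(1)[OF w, of i]
    by unfold_locales (auto simp: admissible_controls_def ell2_def Pi_iff)
  define X where "X t i = linear_ode.sol (d i) (A i) (\<lambda>s. w s i) (x0 i) t" for t i
  \<comment> \<open>The bound of \<open>sol_bound\<close> with \<open>d i\<close> replaced by D: the
    factors must not depend on i for summability to follow from that of the initial data and of
    \<open>q\<close>.\<close>
  define b where "b i = 2 * K\<^sup>2 * (vec_norm2 (x0 i))\<^sup>2 + 2 * (real D)\<^sup>2 * K\<^sup>2 * T * q i" for i
  have X_carrier: "X t i \<in> carrier_vec (d i)" for t i
    unfolding X_def by (rule linear_ode.sol_carrier[OF ode])
  have X_ac: "abs_continuous_on_interval 0 T (\<lambda>t. X t i $ j)" if "j < d i" for i j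
    unfolding X_def using that by (rule linear_ode.sol_abs_continuous[OF ode])
  have "restrict X {0..T} \<in> continuous_ell2 d T"
  proof (rule continuous_ell2I)
    show "summable b"
      unfolding b_def q_def using x0 admissible_controls_square_integrable(2)[OF w]
      by (intro summable_add summable_mult) (auto simp: ell2_def)
    fix t i assume t: "t \<in> {0..T}"
    have "(vec_norm2 (X t i))\<^sup>2 \<le> 2 * K\<^sup>2 * (vec_norm2 (x0 i))\<^sup>2 + 2 * (real (d i))\<^sup>2 * K\<^sup>2 * T * q i"
      unfolding X_def q_def by (rule linear_ode.sol_bound[OF ode K(2,1) t])
    also have "\<dots> \<le> b i"
      unfolding b_def using assms(2)[of i] \<open>0 < T\<close>
      by (intro add_left_mono mult_right_mono mult_left_mono power_mono)
        (auto simp: q_def intro!: Bochner_Integration.integral_nonneg)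
    finally show "(vec_norm2 (X t i))\<^sup>2 \<le> b i" .
  qed (use X_carrier X_ac in \<open>auto intro: abs_continuous_imp_continuous_on\<close>)
  moreover have "AE t in lebesgue_on {0..T}. \<forall>j<d i.
      ((\<lambda>s. restrict X {0..T} s i $ j) has_real_derivative
        (A i *\<^sub>v restrict X {0..T} t i + w t i) $ j) (at t within {0..T})" for i
    using linear_ode.sol_has_derivative[OF ode, of i]
  proof (rule lebesgue_on_mono, intro allI impI)
    fix t j
    assume "\<forall>j<d i. ((\<lambda>s. linear_ode.sol (d i) (A i) (\<lambda>s. w s i) (x0 i) s $ j) has_real_derivative
        (A i *\<^sub>v linear_ode.sol (d i) (A i) (\<lambda>s. w s i) (x0 i) t + w t i) $ j) (at t within {0..T})"
      and t: "t \<in> {0..T}" and j: "j < d i"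
    then have "((\<lambda>s. X s i $ j) has_real_derivative (A i *\<^sub>v X t i + w t i) $ j) (at t within {0..T})"
      by (simp add: X_def)
    then show "((\<lambda>s. restrict X {0..T} s i $ j) has_real_derivative
        (A i *\<^sub>v restrict X {0..T} t i + w t i) $ j) (at t within {0..T})"
      using t by (auto intro: has_field_derivative_transform_within[where d = 1])
  qed
  moreover have "abs_continuous_on_interval 0 T (\<lambda>t. restrict X {0..T} t i $ j)" if "j < d i" for i j
    using X_ac[OF that] by (rule abs_continuous_cong[THEN iffD1, rotated]) auto
  moreover have "restrict X {0..T} 0 i = x0 i" for i
    using linear_ode.sol_0[OF ode, of i] \<open>0 < T\<close> by (simp add: X_def)
  ultimately have sol: "is_solution d T A w x0 (restrict X {0..T})"
    by (auto simp: is_solution_def)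
  have unique: "y t i = X t i" if y: "is_solution d T A w x0 y" and t: "t \<in> {0..T}" for y t i
    unfolding X_def
    by (rule linear_ode.sol_unique[OF ode _ _ _ _ t])
      (use y in \<open>auto simp: is_solution_def continuous_ell2_def ell2_def PiE_iff\<close>)
  \<comment> \<open>Both functions are \<open>undefined\<close> outside [0,T], so agreement on the
    interval is equality of functions, as unique existence demands.\<close>
  have "y = restrict X {0..T}" if y: "is_solution d T A w x0 y" for y
  proof (rule extensionalityI)
    show "y \<in> extensional {0..T}"
      using y by (auto simp: is_solution_def continuous_ell2_def PiE_iff)
  qed (auto simp: fun_eq_iff unique[OF y])
  with sol have "\<exists>!x. is_solution d T A w x0 x" by blast
  \<comment> \<open>The Bochner integral of a nonintegrable function is 0 by default; integrability
    accompanies the formula to give the integral its intended meaning.\<close>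
  moreover have "vec_integrable (d i) 0 t (\<lambda>s. mat_exp ((t - s) \<cdot>\<^sub>m A i) *\<^sub>v w s i) \<and>
      x t i = mat_exp (t \<cdot>\<^sub>m A i) *\<^sub>v x0 i
        + vec_integral (d i) 0 t (\<lambda>s. mat_exp ((t - s) \<cdot>\<^sub>m A i) *\<^sub>v w s i)"
    if "is_solution d T A w x0 x" "t \<in> {0..T}" for x i t
    using unique[OF that, of i] linear_ode.vec_integrable_E_W[OF ode, of t i] that(2)
    by (simp add: X_def linear_ode.sol_def[OF ode])
  ultimately show "(\<exists>!x. is_solution d T A w x0 x) \<and>
    (\<forall>x. is_solution d T A w x0 x \<longrightarrow>
      (\<forall>i. \<forall>t\<in>{0..T}.
        vec_integrable (d i) 0 t (\<lambda>s. mat_exp ((t - s) \<cdot>\<^sub>m A i) *\<^sub>v w s i) \<and>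
        x t i = mat_exp (t \<cdot>\<^sub>m A i) *\<^sub>v x0 i
          + vec_integral (d i) 0 t (\<lambda>s. mat_exp ((t - s) \<cdot>\<^sub>m A i) *\<^sub>v w s i)))"
    by blast
qed

end
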